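(* Let $t>0$ and suppose that $g:[0,t]\times\mathcal X\times\mathcal X\to\mathbb R$ is bounded, measurable and satisfies Condition $C[\nu,t]$ with parameter $\theta>0$. Then for all $\lambda>0$ with $\lambda\le \frac18\min\{\theta,\|g\|_\infty^{-1}\}$ the perturbed process $X^\lambda$ does not explode in $[0,t]$ $\mathbb P_\nu$-almost surely, i.e. $\mathbb P_\nu(\tau^\lambda_\infty>t)=1$.
   Context: Unperturbed process. $(\mathcal X,\mathcal B)$ is a measurable space whose singletons are measurable. $r(x,dy)$ is a transition kernel: for every $x\in\mathcal X$, $r(x,\cdot)$ is a measure on $(\mathcal X,\mathcal B)$ with total mass $\hat r(x):=r(x,\mathcal X)\in(0,+\infty)$ and $r(x,\{x\})=0$; for every $B\in\mathcal B$ the map $x\mapsto r(x,B)$ is measurable. $\nu$ is a probability measure on $(\mathcal X,\mathcal B)$. The unperturbed Markov jump process $(X_s)_{s\ge0}$ has $X_0\sim\nu$; once at $x$ it waits an exponential time of parameter $\hat r(x)$ (independently from the rest) and then jumps to a point chosen with law $r(x,dy)/\hat r(x)$. The explosion time is the supremum of the jump times; after explosion the process is set equal to a cemetery state $\dagger$. Standing assumption: the unperturbed process started from $\nu$ almost surely does not explode. $\mathbb P_\nu,\mathbb E_\nu$ denote probability and expectation when the initial distribution is $\nu$ (the same symbols are used for the perturbed process). Perturbed process. For $\lambda>0$ let $r^\lambda_s(x,dy):=e^{\lambda g(s,x,y)}r(x,dy)$ and $\hat r^\lambda_s(x):=r^\lambda_s(x,\mathcal X)$. The perturbed process $X^\lambda$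 has $X^\lambda_0\sim\nu$; if it arrives at $x$ at time $s$ (or starts there, $s=0$), it stays at $x$ until a random time $\tau$ with $P(\tau>u)=\exp\{-\int_s^u\hat r^\lambda_w(x)\,dw\}$ for $u\ge s$; given $\tau=u$ it jumps at time $u$ to a point chosen with law $r^\lambda_u(x,dy)/\hat r^\lambda_u(x)$, and so on. $\tau^\lambda_\infty$ denotes its explosion time, i.e. the supremum of its jump times. Condition $C[\nu,t]$. For measurable $\alpha:[0,t]\times\mathcal X\times\mathcal X\to\mathbb R$ set $|\alpha|_r(s,x):=\int_{\mathcal X}|\alpha(s,x,y)|\,r(x,dy)$. One says $\alpha$ satisfies Condition $C[\nu,t]$ with parameter $\theta>0$ if $\mathbb E_\nu\big[\exp\{\theta\int_0^t|\alpha|_r(s,X_s)\,ds\}\big]<+\infty$. $\|g\|_\infty$ is the supremum of $|g|$, with the convention $0^{-1}=+\infty$. *)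

theory Defs
  imports "HOL-Probability.Probability"
begin

section \<open>Jump processes\<close>

definition jump_kernel :: "'a measure \<Rightarrow> ('a \<Rightarrow> 'a measure) \<Rightarrow> bool" where
  "jump_kernel M r \<longleftrightarrow>
     (\<forall>x\<in>space M. sets (r x) = sets M \<and>
        0 < emeasure (r x) (space M) \<and> emeasure (r x) (space M) < \<infinity> \<and>
        emeasure (r x) {x} = 0) \<and>
     (\<forall>B\<in>sets M. (\<lambda>x. emeasure (r x) B) \<in> borel_measurable M)"

definition total_rate :: "'a measure \<Rightarrow> 'a measure \<Rightarrow> real" where
  "total_rate M \<mu> = measure \<mu> (space M)"

text \<open>
  A process is given by its jump times \<open>T 0 = 0, T 1, T 2, \<dots>\<close> and by the states
  \<open>Y 0, Y 1, \<dots>\<close>, where \<open>Y n\<close> is entered at time \<open>T n\<close>.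
  The sigma-algebras below are generated by \<open>T 0, Y 0, \<dots>, T n, Y n\<close>, and by these
  variables together with \<open>T (Suc n)\<close>.
\<close>

definition past :: "'w measure \<Rightarrow> 'a measure \<Rightarrow> (nat \<Rightarrow> 'w \<Rightarrow> real) \<Rightarrow> (nat \<Rightarrow> 'w \<Rightarrow> 'a) \<Rightarrow> nat
    \<Rightarrow> 'w measure" where
  "past \<Omega> M T Y n =
     vimage_algebra (space \<Omega>) (\<lambda>\<omega>. \<lambda>i\<in>{..n}. (T i \<omega>, Y i \<omega>))
       (Pi\<^sub>M {..n} (\<lambda>_. borel \<Otimes>\<^sub>M M))"

definition past_next_time :: "'w measure \<Rightarrow> 'a measure \<Rightarrow> (nat \<Rightarrow> 'w \<Rightarrow> real) \<Rightarrow> (nat \<Rightarrow> 'w \<Rightarrow> 'a)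
    \<Rightarrow> nat \<Rightarrow> 'w measure" where
  "past_next_time \<Omega> M T Y n =
     vimage_algebra (space \<Omega>) (\<lambda>\<omega>. (\<lambda>i\<in>{..n}. (T i \<omega>, Y i \<omega>), T (Suc n) \<omega>))
       (Pi\<^sub>M {..n} (\<lambda>_. borel \<Otimes>\<^sub>M M) \<Otimes>\<^sub>M borel)"

text \<open>
  \<open>S s x u\<close>, for \<open>u \<ge> s\<close>, is the probability that a process which arrived at \<open>x\<close> at time \<open>s\<close>
  leaves \<open>x\<close> after time \<open>u\<close>; \<open>q u x\<close> is the jump rate measure at time \<open>u\<close>, which after
  normalisation is the law of the destination of a jump from \<open>x\<close> at time \<open>u\<close>.
\<close>

definition jump_process ::
  "'w measure \<Rightarrow> 'a measure \<Rightarrow> 'a measure \<Rightarrow> (real \<Rightarrow> 'a \<Rightarrow> real \<Rightarrow> real) \<Rightarrow> (real \<Rightarrow> 'a \<Rightarrow> 'a measure)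
    \<Rightarrow> (nat \<Rightarrow> 'w \<Rightarrow> real) \<Rightarrow> (nat \<Rightarrow> 'w \<Rightarrow> 'a) \<Rightarrow> bool" where
  "jump_process \<Omega> M \<nu> S q T Y \<longleftrightarrow>
     prob_space \<Omega> \<and>
     (\<forall>n. T n \<in> borel_measurable \<Omega>) \<and> (\<forall>n. Y n \<in> measurable \<Omega> M) \<and>
     (\<forall>\<omega>\<in>space \<Omega>. T 0 \<omega> = 0) \<and> distr \<Omega> M (Y 0) = \<nu> \<and>
     (\<forall>n u. AE \<omega> in \<Omega>.
        real_cond_exp \<Omega> (past \<Omega> M T Y n) (indicator {\<omega>'\<in>space \<Omega>. T (Suc n) \<omega>' > u}) \<omega> =
          (if u < T n \<omega> then 1 else S (T n \<omega>) (Y n \<omega>) u)) \<and>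
     (\<forall>n. \<forall>D\<in>sets M. AE \<omega> in \<Omega>.
        real_cond_exp \<Omega> (past_next_time \<Omega> M T Y n)
            (indicator {\<omega>'\<in>space \<Omega>. Y (Suc n) \<omega>' \<in> D}) \<omega> =
          measure (q (T (Suc n) \<omega>) (Y n \<omega>)) D / total_rate M (q (T (Suc n) \<omega>) (Y n \<omega>)))"

definition explosion_time :: "(nat \<Rightarrow> 'w \<Rightarrow> real) \<Rightarrow> 'w \<Rightarrow> ereal" where
  "explosion_time T \<omega> = (SUP n. ereal (T n \<omega>))"

text \<open>The value \<open>None\<close> is the cemetery state.\<close>

definition state :: "(nat \<Rightarrow> 'w \<Rightarrow> real) \<Rightarrow> (nat \<Rightarrow> 'w \<Rightarrow> 'a) \<Rightarrow> real \<Rightarrow> 'w \<Rightarrow> 'a option" where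
  "state T Y s \<omega> =
     (if ereal s < explosion_time T \<omega> then Some (Y (LEAST n. s < T (Suc n) \<omega>) \<omega>) else None)"

section \<open>The unperturbed and the perturbed process\<close>

definition unperturbed_process ::
  "'w measure \<Rightarrow> 'a measure \<Rightarrow> 'a measure \<Rightarrow> ('a \<Rightarrow> 'a measure)
    \<Rightarrow> (nat \<Rightarrow> 'w \<Rightarrow> real) \<Rightarrow> (nat \<Rightarrow> 'w \<Rightarrow> 'a) \<Rightarrow> bool" where
  "unperturbed_process \<Omega> M \<nu> r T Y \<longleftrightarrow>
     jump_process \<Omega> M \<nu> (\<lambda>s x u. exp (- (total_rate M (r x) * (u - s)))) (\<lambda>_. r) T Y"

text \<open>
  The function \<open>g\<close> is only given on \<open>[0,t]\<close>; beyond time \<open>t\<close> it is continued by \<open>0\<close>, so that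
  the process then follows the unperturbed dynamics. This choice does not affect the process up
  to time \<open>t\<close>.
\<close>

definition perturbed_rate ::
  "real \<Rightarrow> real \<Rightarrow> (real \<Rightarrow> 'a \<Rightarrow> 'a \<Rightarrow> real) \<Rightarrow> ('a \<Rightarrow> 'a measure) \<Rightarrow> real \<Rightarrow> 'a \<Rightarrow> 'a measure" where
  "perturbed_rate t lam g r s x =
     density (r x) (\<lambda>y. ennreal (exp (lam * (if s \<in> {0..t} then g s x y else 0))))"

definition perturbed_process ::
  "'w measure \<Rightarrow> 'a measure \<Rightarrow> 'a measure \<Rightarrow> ('a \<Rightarrow> 'a measure) \<Rightarrow> real \<Rightarrow> real
    \<Rightarrow> (real \<Rightarrow> 'a \<Rightarrow> 'a \<Rightarrow> real) \<Rightarrow> (nat \<Rightarrow> 'w \<Rightarrow> real) \<Rightarrow> (nat \<Rightarrow> 'w \<Rightarrow> 'a) \<Rightarrow> bool" where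
  "perturbed_process \<Omega> M \<nu> r t lam g T Y \<longleftrightarrow>
     jump_process \<Omega> M \<nu>
       (\<lambda>s x u. exp (- (LINT w:{s..u}|lborel. total_rate M (perturbed_rate t lam g r w x))))
       (perturbed_rate t lam g r) T Y"

section \<open>The exponential moment condition\<close>

definition exp_ennreal :: "ennreal \<Rightarrow> ennreal" where
  "exp_ennreal z = (if z = \<infinity> then \<infinity> else ennreal (exp (enn2real z)))"

definition abs_rate :: "('a \<Rightarrow> 'a measure) \<Rightarrow> (real \<Rightarrow> 'a \<Rightarrow> 'a \<Rightarrow> real) \<Rightarrow> real \<Rightarrow> 'a \<Rightarrow> ennreal" where
  "abs_rate r \<alpha> s x = (\<integral>\<^sup>+ y. ennreal \<bar>\<alpha> s x y\<bar> \<partial>r x)"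

text \<open>\<open>T, Y\<close> is the unperturbed process; the cemetery state contributes \<open>0\<close> to the time integral.\<close>

definition condition_C ::
  "'w measure \<Rightarrow> ('a \<Rightarrow> 'a measure) \<Rightarrow> (nat \<Rightarrow> 'w \<Rightarrow> real) \<Rightarrow> (nat \<Rightarrow> 'w \<Rightarrow> 'a) \<Rightarrow> real \<Rightarrow> real
    \<Rightarrow> (real \<Rightarrow> 'a \<Rightarrow> 'a \<Rightarrow> real) \<Rightarrow> bool" where
  "condition_C \<Omega> r T Y t \<theta> \<alpha> \<longleftrightarrow>
     (\<integral>\<^sup>+ \<omega>. exp_ennreal (ennreal \<theta> *
         (\<integral>\<^sup>+ s\<in>{0..t}. (case state T Y s \<omega> of None \<Rightarrow> 0 | Some x \<Rightarrow> abs_rate r \<alpha> s x) \<partial>lborel))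
       \<partial>\<Omega>) < \<infinity>"

definition sup_abs :: "'a measure \<Rightarrow> real \<Rightarrow> (real \<Rightarrow> 'a \<Rightarrow> 'a \<Rightarrow> real) \<Rightarrow> ereal" where
  "sup_abs M t g = (SUP (s, x, y)\<in>{0..t} \<times> space M \<times> space M. ereal \<bar>g s x y\<bar>)"

end

theory Submission
  imports Defs
begin

text \<open>
  On the event that the \<open>n\<close>-th jump happens before \<open>t\<close>, the law of the perturbed process has a density
  \<open>Z\<^sub>n\<close> with respect to the unperturbed one. Writing \<open>W\<^sub>n\<close> for the analogous density with \<open>2\<lambda>\<close> in
  place of \<open>\<lambda>\<close>, one has \<open>Z\<^sub>n\<^sup>2 = W\<^sub>n V\<^sub>n\<close>, where \<open>V\<^sub>n\<close> is the exponential of the time integral of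
  \<open>\<integral>(e\<^bsup>\<lambda>g\<^esup> - 1)\<^sup>2 dr \<le> \<theta> |g|\<^sub>r\<close>. Since \<open>W\<^sub>n\<close> has total mass at most \<open>1\<close>, the inequality
  \<open>Z\<^sub>n \<le> \<delta> W\<^sub>n + V\<^sub>n / (4\<delta>)\<close> bounds the probability of \<open>n\<close> jumps of the perturbed process before \<open>t\<close> by \<open>\<delta>\<close>
  plus a multiple of the unperturbed expectation of \<open>V\<^sub>n\<close> on the event of \<open>n\<close> jumps before \<open>t\<close>. The latter
  vanishes as \<open>n \<rightarrow> \<infinity>\<close> by dominated convergence. The densities are only used implicitly, through the
  recursions over the first jump that the expectations satisfy.
\<close>

section \<open>Exponential waiting times with a bounded measurable rate\<close>

text \<open>The two processes live on unrelated probability spaces and are known only through their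
  conditional laws, so a likelihood ratio is not a random variable on either space. What they share
  is \<nu>: expectations on both sides become integrals against \<nu> of deterministic functions
  \<open>backward\<close>, and the comparison takes place between those functions. The parameter
  2\<lambda> comes from squaring: a jump factor exp(\<lambda>g) becomes exp(2\<lambda>g), and the
  waiting factors then differ by exp(2\<lambda>g) - 2 exp(\<lambda>g) + 1, a perfect square. A
  process with parameter 2\<lambda> could itself explode; it is never constructed, and only
  sub-probability masses of its one-step laws enter. Cauchy-Schwarz appears in additive form because
  that form is linear in both densities and so passes through the integration over a single jump.
  Finally, the square is quadratic in \<lambda>g while Condition C controls \<open>|g|_r\<close>
  only linearly: the bound on \<lambda>|g| absorbs one factor, and the bound of \<lambda> by
  \<theta> handles the other.\<close>

lemma nn_integral_exp_minus_tail: "(\<integral>\<^sup>+z. ennreal (exp (- z)) * indicator {a..} z \<partial>lborel) = ennreal (exp (- a))"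
proof -
  have "((\<lambda>z::real. - exp (- z)) \<longlongrightarrow> - 0) at_top"
    by (intro tendsto_minus filterlim_compose[OF exp_at_bot filterlim_uminus_at_bot_at_top])
  then have "(\<integral>\<^sup>+z. ennreal (exp (- z)) * indicator {a..} z \<partial>lborel) = ennreal (0 - (- exp (- a)))"
    by (intro nn_integral_FTC_atLeast) (auto intro!: derivative_eq_intros)
  then show ?thesis by simp
qed

definition cumulative_rate :: "(real \<Rightarrow> real) \<Rightarrow> real \<Rightarrow> real \<Rightarrow> real" where
  "cumulative_rate \<rho> a b = (LINT w:{a..b}|lborel. \<rho> w)"

lemma set_integrable_bounded_Icc:
  fixes \<rho> :: "real \<Rightarrow> real"
  assumes "\<rho> \<in> borel_measurable borel" "\<And>w. \<bar>\<rho> w\<bar> \<le> C"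
  shows "set_integrable lborel {a..b} \<rho>"
  unfolding set_integrable_def
  using assms by (intro integrableI_bounded_set_indicator[where B=C]) (auto simp: emeasure_lborel_Icc_eq)

lemma ennreal_cumulative:
  assumes "\<rho> \<in> borel_measurable borel" "\<And>w. 0 \<le> \<rho> w" "\<And>w. \<rho> w \<le> C"
  shows "ennreal (cumulative_rate \<rho> a b) = (\<integral>\<^sup>+w. ennreal (\<rho> w) * indicator {a..b} w \<partial>lborel)"
proof -
  have "set_integrable lborel {a..b} \<rho>"
    using assms by (intro set_integrable_bounded_Icc[where C=C]) auto
  then have "(\<integral>\<^sup>+w. ennreal (indicator {a..b} w *\<^sub>R \<rho> w) \<partial>lborel) = ennreal (cumulative_rate \<rho> a b)"
    unfolding cumulative_rate_def set_lebesgue_integral_def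
    using assms(2) by (intro nn_integral_eq_integral) (auto simp: set_integrable_def)
  moreover have "ennreal (indicator {a..b} w *\<^sub>R \<rho> w) = ennreal (\<rho> w) * indicator {a..b} w" for w
    by (auto split: split_indicator)
  ultimately show ?thesis by simp
qed

text \<open>This models the rate of leaving one fixed state as a function of time. The rate is
  merely measurable, so no derivative of the cumulative rate is available everywhere; the lower
  bound makes the cumulative rate strictly increasing and unbounded, the upper bound makes it
  Lipschitz, and these facts replace a change of variables.\<close>

locale bounded_rate =
  fixes \<rho> :: "real \<Rightarrow> real" and c C :: real
  assumes rate_measurable [measurable]: "\<rho> \<in> borel_measurable borel"
    and c_pos: "0 < c" and rate_lower: "c \<le> \<rho> w" and rate_upper: "\<rho> w \<le> C"
begin

lemma rate_pos: "0 < \<rho> w" 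
  using c_pos rate_lower[of w] by simp

lemma rate_integrable: "set_integrable lborel {a..b} \<rho>"
  using rate_pos rate_upper
  by (intro set_integrable_bounded_Icc[where C=C]) (simp_all add: abs_of_pos)

lemma ennreal_cumulative_rate:
  "ennreal (cumulative_rate \<rho> a b) = (\<integral>\<^sup>+w. ennreal (\<rho> w) * indicator {a..b} w \<partial>lborel)"
  using rate_pos[THEN less_imp_le] rate_upper by (intro ennreal_cumulative) auto

lemma cumulative_rate_add:
  assumes "a \<le> b" "b \<le> d"
  shows "cumulative_rate \<rho> a d = cumulative_rate \<rho> a b + cumulative_rate \<rho> b d"
proof -
  have "(LINT w:{a..b} \<union> {b..d}|lborel. \<rho> w) = (LINT w:{a..b}|lborel. \<rho> w) + (LINT w:{b..d}|lborel. \<rho> w)"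
  proof (rule set_integral_Un_AE)
    show "AE x in lborel. \<not> (x \<in> {a..b} \<and> x \<in> {b..d})"
      by (rule AE_mp[OF AE_lborel_singleton[of b]]) auto
  qed (auto intro: rate_integrable)
  then show ?thesis
    using assms by (simp add: cumulative_rate_def ivl_disj_un_two_touch)
qed

lemma cumulative_rate_lower: "a \<le> b \<Longrightarrow> c * (b - a) \<le> cumulative_rate \<rho> a b"
  using set_integral_mono[of lborel "{a..b}" "\<lambda>_. c" \<rho>] rate_integrable[of a b] rate_lower
  by (simp add: cumulative_rate_def set_lebesgue_integral_def set_integrable_def mult.commute)

lemma cumulative_rate_upper: "a \<le> b \<Longrightarrow> cumulative_rate \<rho> a b \<le> C * (b - a)"
  using set_integral_mono[of lborel "{a..b}" \<rho> "\<lambda>_. C"] rate_integrable[of a b] rate_upper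
  by (simp add: cumulative_rate_def set_lebesgue_integral_def set_integrable_def mult.commute)

lemma cumulative_rate_nonneg: "0 \<le> cumulative_rate \<rho> a b"
  unfolding cumulative_rate_def set_lebesgue_integral_def
  using rate_pos[THEN less_imp_le] by (intro integral_nonneg_AE) simp

lemma cumulative_rate_self: "cumulative_rate \<rho> a a = 0"
  using cumulative_rate_lower[of a a] cumulative_rate_upper[of a a] by simp

lemma cumulative_rate_strict_mono:
  assumes "a \<le> b" "b < d"
  shows "cumulative_rate \<rho> a b < cumulative_rate \<rho> a d"
proof -
  have "0 < c * (d - b)" using assms c_pos by simp
  then show ?thesis
    using cumulative_rate_add[of a b d] cumulative_rate_lower[of b d] assms by simp
qed

lemma cumulative_rate_measurable [measurable]: "cumulative_rate \<rho> a \<in> borel_measurable borel"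
  unfolding cumulative_rate_def[abs_def] set_lebesgue_integral_def
proof (rule lborel.borel_measurable_lebesgue_integral)
  have "(\<lambda>(b, w). (if a \<le> w \<and> w \<le> b then 1 else 0) *\<^sub>R \<rho> w) \<in> borel_measurable (borel \<Otimes>\<^sub>M borel)"
    by measurable
  then show "(\<lambda>(b, w). indicat_real {a..b} w *\<^sub>R \<rho> w) \<in> borel_measurable (borel \<Otimes>\<^sub>M lborel)"
    by (simp add: indicator_def)
qed

text \<open>Intermediate value theorem on \<open>{a..a + z / c}\<close>: the cumulative rate is
  Lipschitz there, starts at 0, and the lower bound \<open>c\<close> pushes it to at least
  \<open>z\<close> at the right end.\<close>

lemma cumulative_rate_surj:
  assumes "0 \<le> z"
  obtains b where "a \<le> b" "cumulative_rate \<rho> a b = z"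
proof -
  have C: "0 \<le> C" using rate_pos[of 0] rate_upper[of 0] by simp
  have "C-lipschitz_on {a..a + z / c} (cumulative_rate \<rho> a)"
  proof (rule lipschitz_on_leI)
    fix u v assume uv: "u \<in> {a..a + z / c}" "v \<in> {a..a + z / c}" "u \<le> v"
    then show "dist (cumulative_rate \<rho> a u) (cumulative_rate \<rho> a v) \<le> C * dist u v"
      using cumulative_rate_add[of a u v] cumulative_rate_upper[of u v] cumulative_rate_nonneg[of u v]
      by (simp add: dist_real_def abs_minus_commute)
  qed (use C in simp)
  from IVT'[of "cumulative_rate \<rho> a", OF _ _ _ lipschitz_on_continuous_on[OF this], of z]
  show ?thesis
    using assms c_pos that cumulative_rate_lower[of a "a + z / c"] cumulative_rate_self[of a] by auto
qed

text \<open>Instead of differentiating, exp(-I v) is written as the integral of exp(-z) over z \<ge>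
  I v and the two integrations are exchanged. The inner integral of the rate over the times with I v
  \<le> z is z itself.\<close>

lemma nn_integral_rate_exp_cumulative:
  "(\<integral>\<^sup>+v. ennreal (\<rho> v * exp (- cumulative_rate \<rho> u v)) * indicator {u<..} v \<partial>lborel) = 1"
proof -
  let ?I = "cumulative_rate \<rho> u"
  let ?f = "\<lambda>v z. ennreal (\<rho> v) * ennreal (exp (- z)) * indicator {v. u < v \<and> ?I v \<le> z} v"
  have inner: "(\<integral>\<^sup>+v. ennreal (\<rho> v) * indicator {v. u < v \<and> ?I v \<le> z} v \<partial>lborel)
      = ennreal z * indicator {0..} z" for z
  proof (cases "0 \<le> z")
    case True
    \<comment> \<open>With \<open>b\<close> the time at which the cumulative rate reaches
      \<open>z\<close>, strict monotonicity turns the sublevel set into the interval from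
      \<open>u\<close> to \<open>b\<close>, over which the rate integrates to
      \<open>z\<close>.\<close>
    then obtain b where b: "u \<le> b" "?I b = z" by (rule cumulative_rate_surj)
    have "?I v \<le> z \<longleftrightarrow> v \<le> b" if "u < v" for v
      using cumulative_rate_strict_mono[of u v b] cumulative_rate_strict_mono[of u b v] that b
      by (cases v b rule: linorder_cases) auto
    then have "{v. u < v \<and> ?I v \<le> z} = {u<..b}" by auto
    moreover have "(\<integral>\<^sup>+v. ennreal (\<rho> v) * indicator {u<..b} v \<partial>lborel)
        = (\<integral>\<^sup>+v. ennreal (\<rho> v) * indicator {u..b} v \<partial>lborel)"
      by (rule nn_integral_cong_AE, rule AE_mp[OF AE_lborel_singleton[of u]]) (auto split: split_indicator)
    ultimately show ?thesis
      using ennreal_cumulative_rate[of u b] b True by simp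
  next
    case False
    then have "{v. u < v \<and> ?I v \<le> z} = {}"
      using cumulative_rate_nonneg[of u] using False by (auto intro: order_trans)
    then show ?thesis using False by simp
  qed
  have "(\<integral>\<^sup>+v. ennreal (\<rho> v * exp (- ?I v)) * indicator {u<..} v \<partial>lborel)
      = (\<integral>\<^sup>+v. (\<integral>\<^sup>+z. ?f v z \<partial>lborel) \<partial>lborel)"
  proof (rule nn_integral_cong)
    fix v :: real
    have "(\<integral>\<^sup>+z. ?f v z \<partial>lborel)
        = (\<integral>\<^sup>+z. (ennreal (\<rho> v) * indicator {u<..} v) * (ennreal (exp (- z)) * indicator {?I v..} z) \<partial>lborel)"
      by (intro nn_integral_cong) (auto split: split_indicator)
    also have "\<dots> = (ennreal (\<rho> v) * indicator {u<..} v) * ennreal (exp (- ?I v))"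
      by (simp add: nn_integral_cmult nn_integral_exp_minus_tail)
    finally show "ennreal (\<rho> v * exp (- ?I v)) * indicator {u<..} v = (\<integral>\<^sup>+z. ?f v z \<partial>lborel)"
      using rate_pos[of v] by (simp add: ennreal_mult' mult_ac)
  qed
  also have "\<dots> = (\<integral>\<^sup>+z. (\<integral>\<^sup>+v. ?f v z \<partial>lborel) \<partial>lborel)"
    by (rule lborel_pair.Fubini') (unfold indicator_def, measurable)
  also have "\<dots> = (\<integral>\<^sup>+z. ennreal (exp (- z)) * (ennreal z * indicator {0..} z) \<partial>lborel)"
  proof (rule nn_integral_cong)
    fix z :: real
    have "(\<integral>\<^sup>+v. ?f v z \<partial>lborel)
        = (\<integral>\<^sup>+v. ennreal (exp (- z)) * (ennreal (\<rho> v) * indicator {v. u < v \<and> ?I v \<le> z} v) \<partial>lborel)"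
      by (simp add: mult_ac)
    also have "\<dots> = ennreal (exp (- z)) * (\<integral>\<^sup>+v. ennreal (\<rho> v) * indicator {v. u < v \<and> ?I v \<le> z} v \<partial>lborel)"
      by (intro nn_integral_cmult) (unfold indicator_def, measurable)
    finally show "(\<integral>\<^sup>+v. ?f v z \<partial>lborel) = ennreal (exp (- z)) * (ennreal z * indicator {0..} z)"
      by (simp only: inner)
  qed
  also have "\<dots> = (\<integral>\<^sup>+z. ennreal (z ^ 1 * exp (- z)) * indicator {0..} z \<partial>lborel)"
    by (intro nn_integral_cong) (auto simp: ennreal_mult' mult_ac split: split_indicator)
  \<comment> \<open>The mean of a standard exponential variable, that is, the factorial of
    1.\<close>
  also have "\<dots> = 1"
    by (subst nn_intergal_power_times_exp_Ici) simp
  finally show ?thesis .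
qed

text \<open>Lack of memory: by additivity of the cumulative rate, the survival factor up to
  \<open>u\<close> splits off, and a law restarted at \<open>u\<close>, of mass 1, remains.\<close>

lemma nn_integral_rate_exp_cumulative_tail:
  assumes "s \<le> u"
  shows "(\<integral>\<^sup>+v. ennreal (\<rho> v * exp (- cumulative_rate \<rho> s v)) * indicator {u<..} v \<partial>lborel)
    = ennreal (exp (- cumulative_rate \<rho> s u))"
proof -
  have "(\<integral>\<^sup>+v. ennreal (\<rho> v * exp (- cumulative_rate \<rho> s v)) * indicator {u<..} v \<partial>lborel)
    = (\<integral>\<^sup>+v. ennreal (exp (- cumulative_rate \<rho> s u)) *
        (ennreal (\<rho> v * exp (- cumulative_rate \<rho> u v)) * indicator {u<..} v) \<partial>lborel)"
  proof (rule nn_integral_cong)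
    fix v
    show "ennreal (\<rho> v * exp (- cumulative_rate \<rho> s v)) * indicator {u<..} v =
      ennreal (exp (- cumulative_rate \<rho> s u)) *
        (ennreal (\<rho> v * exp (- cumulative_rate \<rho> u v)) * indicator {u<..} v)"
      using cumulative_rate_add[of s u v] assms rate_pos[of v]
      by (auto split: split_indicator simp: exp_diff ennreal_mult'[symmetric] exp_minus field_simps exp_add)
  qed
  also have "\<dots> = ennreal (exp (- cumulative_rate \<rho> s u))"
    by (subst nn_integral_cmult) (auto simp: nn_integral_rate_exp_cumulative)
  finally show ?thesis .
qed

end

section \<open>Disintegration along a conditional law\<close>

text \<open>The joint law of the point and \<open>Z\<close> on F \<otimes> N is determined by its
  values on rectangles B \<times> D with \<open>B\<close> in \<open>F\<close> and \<open>D\<close>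
  in a generator, and there the conditional probabilities identify it. Allowing a generator matters
  because conditional laws of jump times are given only through their tails, while those of
  destinations are given on all measurable sets. The integrand may depend on the whole past through
  its first argument.\<close>

lemma (in prob_space) nn_integral_conditional_kernel:
  assumes F: "subalgebra M F" and Z [measurable]: "Z \<in> measurable M N"
    and \<kappa>: "\<kappa> \<in> measurable F (prob_algebra N)"
    and gen: "Int_stable G" "G \<subseteq> Pow (space N)" "sets N = sigma_sets (space N) G"
    and cover: "range A \<subseteq> G" "(\<Union>i::nat. A i) = space N"
    and cond: "\<And>D. D \<in> G \<Longrightarrow>
      AE \<omega> in M. real_cond_exp M F (indicator {\<omega>\<in>space M. Z \<omega> \<in> D}) \<omega> = measure (\<kappa> \<omega>) D"
    and f: "f \<in> borel_measurable (F \<Otimes>\<^sub>M N)"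
  shows "(\<integral>\<^sup>+\<omega>. f (\<omega>, Z \<omega>) \<partial>M) = (\<integral>\<^sup>+\<omega>. \<integral>\<^sup>+z. f (\<omega>, z) \<partial>\<kappa> \<omega> \<partial>M)"
proof -
  have space_F: "space F = space M" and sets_F: "sets F \<subseteq> sets M"
    using F by (auto simp: subalgebra_def)
  have [measurable]: "\<kappa> \<in> measurable F (subprob_algebra N)"
    using \<kappa> by (rule measurable_prob_algebraD)
  have F_id [measurable]: "(\<lambda>\<omega>. \<omega>) \<in> measurable M F"
    using F by (rule measurable_from_subalg) simp
  have [measurable]: "\<kappa> \<in> measurable M (subprob_algebra N)"
    by (rule measurable_from_subalg[OF F]) fact
  interpret F: finite_measure_subalgebra M F
    by standard (rule F)
  \<comment> \<open>The kernel is pushed to the product so that it remembers its starting point;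
    binding with it yields the candidate joint law.\<close>
  let ?K = "\<lambda>\<omega>. distr (\<kappa> \<omega>) (F \<Otimes>\<^sub>M N) (Pair \<omega>)"
  have "(\<lambda>p. (fst p, snd p)) \<in> measurable (M \<Otimes>\<^sub>M N) (F \<Otimes>\<^sub>M N)"
    by (intro measurable_Pair measurable_compose[OF measurable_fst F_id] measurable_snd)
  then have pair: "id \<in> measurable (M \<Otimes>\<^sub>M N) (F \<Otimes>\<^sub>M N)"
    by (simp add: id_def)
  have K [measurable]: "?K \<in> measurable M (subprob_algebra (F \<Otimes>\<^sub>M N))"
    by (rule measurable_distr2[where M = N and f = Pair]) (use pair in simp_all)
  have ne: "space M \<noteq> {}" by (rule not_empty)
  have sets_\<kappa>: "sets (\<kappa> \<omega>) = sets N" if "\<omega> \<in> space M" for \<omega>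
    using \<kappa> that by (auto simp: space_F[symmetric] dest!: measurable_space simp: space_prob_algebra)
  have prob_\<kappa>: "prob_space (\<kappa> \<omega>)" if "\<omega> \<in> space M" for \<omega>
    using \<kappa> that by (auto simp: space_F[symmetric] dest!: measurable_space simp: space_prob_algebra)
  have G_sets: "D \<in> sets N" if "D \<in> G" for D
    using that gen(3) by auto
  have box: "emeasure (distr M (F \<Otimes>\<^sub>M N) (\<lambda>\<omega>. (\<omega>, Z \<omega>))) (B \<times> D) = emeasure (M \<bind> ?K) (B \<times> D)"
    if B: "B \<in> sets F" and D: "D \<in> G" for B D
  proof -
    note [measurable] = G_sets[OF D] B
    have BM [measurable]: "B \<in> sets M" using B sets_F by auto
    have int: "integrable M (indicator {\<omega>\<in>space M. Z \<omega> \<in> D} :: _ \<Rightarrow> real)"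
      by (rule integrable_real_indicator) (auto simp: emeasure_eq_measure)
    have "emeasure (M \<bind> ?K) (B \<times> D) = (\<integral>\<^sup>+\<omega>. emeasure (?K \<omega>) (B \<times> D) \<partial>M)"
      using ne by (intro emeasure_bind) (auto intro: K)
    also have "\<dots> = (\<integral>\<^sup>+\<omega>. ennreal (indicator B \<omega> * measure (\<kappa> \<omega>) D) \<partial>M)"
    proof (rule nn_integral_cong)
      fix \<omega> assume \<omega>: "\<omega> \<in> space M"
      interpret \<kappa>: prob_space "\<kappa> \<omega>" using prob_\<kappa>[OF \<omega>] .
      have [measurable_cong]: "sets (\<kappa> \<omega>) = sets N" by (rule sets_\<kappa>[OF \<omega>])
      have "emeasure (?K \<omega>) (B \<times> D) = emeasure (\<kappa> \<omega>) (Pair \<omega> -` (B \<times> D) \<inter> space (\<kappa> \<omega>))"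
        using \<omega> space_F by (intro emeasure_distr) auto
      also have "Pair \<omega> -` (B \<times> D) \<inter> space (\<kappa> \<omega>) = (if \<omega> \<in> B then D else {})"
        using sets.sets_into_space[OF G_sets[OF D]] sets_eq_imp_space_eq[OF sets_\<kappa>[OF \<omega>]] by auto
      finally show "emeasure (?K \<omega>) (B \<times> D) = ennreal (indicator B \<omega> * measure (\<kappa> \<omega>) D)"
        by (simp add: \<kappa>.emeasure_eq_measure)
    qed
    \<comment> \<open>The hypothesis holds almost everywhere for each single \<open>D\<close>, with
      a null set depending on \<open>D\<close>; this suffices because \<open>D\<close> is fixed
      before integrating.\<close>
    also have "\<dots> = (\<integral>\<^sup>+\<omega>. ennreal (indicator B \<omega> * real_cond_exp M F (indicator {\<omega>\<in>space M. Z \<omega> \<in> D}) \<omega>) \<partial>M)"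
      using cond[OF D] by (intro nn_integral_cong_AE) auto
    also have "\<dots> = ennreal (\<integral>\<omega>. indicator B \<omega> * real_cond_exp M F (indicator {\<omega>\<in>space M. Z \<omega> \<in> D}) \<omega> \<partial>M)"
    proof (rule nn_integral_eq_integral)
      show "integrable M (\<lambda>\<omega>. indicator B \<omega> * real_cond_exp M F (indicator {\<omega>\<in>space M. Z \<omega> \<in> D}) \<omega>)"
        using integrable_mult_indicator[OF BM F.real_cond_exp_int(1)[OF int]] by simp
      show "AE \<omega> in M. 0 \<le> indicator B \<omega> * real_cond_exp M F (indicator {\<omega>\<in>space M. Z \<omega> \<in> D}) \<omega>"
        using cond[OF D] by eventually_elim simp
    qed
    \<comment> \<open>Defining property of conditional expectation, applicable because
      \<open>B\<close> belongs to \<open>F\<close>.\<close>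
    also have "\<dots> = ennreal (\<integral>\<omega>. indicator B \<omega> * indicator {\<omega>\<in>space M. Z \<omega> \<in> D} \<omega> \<partial>M)"
      using integrable_mult_indicator[OF BM int] B int
      by (subst F.real_cond_exp_intg) (auto intro: borel_measurable_integrable)
    also have "\<dots> = ennreal (measure M (B \<inter> {\<omega>\<in>space M. Z \<omega> \<in> D}))"
      by (simp add: indicator_inter_arith[symmetric] Int_absorb2 le_infI1 sets.sets_into_space)
    also have "\<dots> = emeasure M ((\<lambda>\<omega>. (\<omega>, Z \<omega>)) -` (B \<times> D) \<inter> space M)"
      using sets.sets_into_space[OF BM]
      by (auto simp: emeasure_eq_measure intro!: arg_cong[where f="measure M"])
    also have "\<dots> = emeasure (distr M (F \<Otimes>\<^sub>M N) (\<lambda>\<omega>. (\<omega>, Z \<omega>))) (B \<times> D)"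
      by (rule emeasure_distr[symmetric]) auto
    finally show ?thesis by simp
  qed
  have "distr M (F \<Otimes>\<^sub>M N) (\<lambda>\<omega>. (\<omega>, Z \<omega>)) = M \<bind> ?K"
  proof (rule measure_eqI_generator_eq)
    let ?E = "{B \<times> D | B D. B \<in> sets F \<and> D \<in> G}"
    show "Int_stable ?E"
    proof (rule Int_stableI)
      fix a b assume "a \<in> ?E" "b \<in> ?E"
      then obtain B D B' D' where "a = B \<times> D" "b = B' \<times> D'" "B \<in> sets F" "B' \<in> sets F" "D \<in> G" "D' \<in> G"
        by auto
      then have "a \<inter> b = (B \<inter> B') \<times> (D \<inter> D')" "B \<inter> B' \<in> sets F" "D \<inter> D' \<in> G"
        using gen(1) by (auto simp: Int_stable_def)
      then show "a \<inter> b \<in> ?E" by blast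
    qed
    show "?E \<subseteq> Pow (space F \<times> space N)"
      using gen(2) sets.sets_into_space by blast
    have "sets (F \<Otimes>\<^sub>M N) = sigma_sets (space F \<times> space N) ?E"
    proof -
      have "sigma (space F) (sets F) \<Otimes>\<^sub>M sigma (space N) G = sigma (space F \<times> space N) ?E"
      proof (rule sigma_prod)
        show "\<exists>E\<subseteq>sets F. countable E \<and> space F = \<Union>E"
          by (intro exI[of _ "{space F}"]) auto
        show "\<exists>E\<subseteq>G. countable E \<and> space N = \<Union>E"
          using cover by (intro exI[of _ "range A"]) auto
      qed (use gen(2) sets.space_closed[of F] in auto)
      moreover have "sets (sigma (space F) (sets F) \<Otimes>\<^sub>M sigma (space N) G) = sets (F \<Otimes>\<^sub>M N)"
        using gen(2,3) by (intro sets_pair_measure_cong) (simp_all add: sets.space_closed)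
      ultimately show ?thesis
        using \<open>?E \<subseteq> Pow (space F \<times> space N)\<close> by (metis (no_types, lifting) sets_measure_of)
    qed
    then show "sets (distr M (F \<Otimes>\<^sub>M N) (\<lambda>\<omega>. (\<omega>, Z \<omega>))) = sigma_sets (space F \<times> space N) ?E"
      "sets (M \<bind> ?K) = sigma_sets (space F \<times> space N) ?E"
      using ne K by (simp_all add: sets_bind[where N="F \<Otimes>\<^sub>M N"])
    \<comment> \<open>The whole space need not belong to the generator (it is no open half-line),
      hence the exhausting sequence \<open>A\<close>.\<close>
    show "range (\<lambda>i. space F \<times> A i) \<subseteq> ?E" using cover(1) by auto
    show "(\<Union>i. space F \<times> A i) = space F \<times> space N" using cover(2) by auto
    have "finite_measure (distr M (F \<Otimes>\<^sub>M N) (\<lambda>\<omega>. (\<omega>, Z \<omega>)))"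
      by (rule finite_measure_distr) measurable
    then show "emeasure (distr M (F \<Otimes>\<^sub>M N) (\<lambda>\<omega>. (\<omega>, Z \<omega>))) (space F \<times> A i) \<noteq> \<infinity>" for i
      by (simp add: finite_measure.emeasure_finite)
  qed (use box in auto)
  then have "(\<integral>\<^sup>+p. f p \<partial>distr M (F \<Otimes>\<^sub>M N) (\<lambda>\<omega>. (\<omega>, Z \<omega>))) = (\<integral>\<^sup>+p. f p \<partial>(M \<bind> ?K))"
    by simp
  also have "\<dots> = (\<integral>\<^sup>+\<omega>. \<integral>\<^sup>+p. f p \<partial>?K \<omega> \<partial>M)"
    using f K by (rule nn_integral_bind)
  also have "\<dots> = (\<integral>\<^sup>+\<omega>. \<integral>\<^sup>+z. f (\<omega>, z) \<partial>\<kappa> \<omega> \<partial>M)"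
  proof (rule nn_integral_cong)
    fix \<omega> assume \<omega>: "\<omega> \<in> space M"
    have [measurable_cong]: "sets (\<kappa> \<omega>) = sets N" by (rule sets_\<kappa>[OF \<omega>])
    show "(\<integral>\<^sup>+p. f p \<partial>?K \<omega>) = (\<integral>\<^sup>+z. f (\<omega>, z) \<partial>\<kappa> \<omega>)"
      using f \<omega> space_F by (subst nn_integral_distr) auto
  qed
  finally show ?thesis
    using f by (simp add: nn_integral_distr)
qed

section \<open>Tilted jump kernels\<close>

lemma cumulative_rate_measurable_param [measurable (raw)]:
  assumes [measurable]: "(\<lambda>(w, x). \<rho> w x) \<in> borel_measurable (borel \<Otimes>\<^sub>M M)"
    "X \<in> measurable N M" "a \<in> borel_measurable N" "b \<in> borel_measurable N"
  shows "(\<lambda>z. cumulative_rate (\<lambda>w. \<rho> w (X z)) (a z) (b z)) \<in> borel_measurable N"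
  unfolding cumulative_rate_def set_lebesgue_integral_def
proof (rule lborel.borel_measurable_lebesgue_integral)
  have "(\<lambda>(z, w). (if a z \<le> w \<and> w \<le> b z then 1 else 0) *\<^sub>R \<rho> w (X z)) \<in> borel_measurable (N \<Otimes>\<^sub>M borel)"
    by measurable
  then show "(\<lambda>(z, w). indicat_real {a z..b z} w *\<^sub>R \<rho> w (X z)) \<in> borel_measurable (N \<Otimes>\<^sub>M lborel)"
    by (simp add: indicator_def)
qed

text \<open>\<open>G\<close> stands for the perturbation continued to all times. The strength of the
  tilt is left out of the locale on purpose: the argument compares the tilts 0, \<lambda> and
  2\<lambda> of the same kernel.\<close>

locale bounded_perturbation =
  fixes M :: "'a measure" and r :: "'a \<Rightarrow> 'a measure" and G :: "real \<Rightarrow> 'a \<Rightarrow> 'a \<Rightarrow> real" and B :: real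
  assumes kernel: "jump_kernel M r"
    and G_measurable: "(\<lambda>(u, x, y). G u x y) \<in> borel_measurable (borel \<Otimes>\<^sub>M M \<Otimes>\<^sub>M M)"
    and G_bounded: "x \<in> space M \<Longrightarrow> y \<in> space M \<Longrightarrow> \<bar>G u x y\<bar> \<le> B"
begin

lemma G_measurable_raw [measurable (raw)]:
  assumes [measurable]: "u \<in> borel_measurable N" "x \<in> measurable N M" "y \<in> measurable N M"
  shows "(\<lambda>z. G (u z) (x z) (y z)) \<in> borel_measurable N"
proof -
  have "(\<lambda>z. (u z, x z, y z)) \<in> measurable N (borel \<Otimes>\<^sub>M M \<Otimes>\<^sub>M M)" by measurable
  from measurable_compose[OF this G_measurable] show ?thesis by simp
qed

lemma sets_kernel: "x \<in> space M \<Longrightarrow> sets (r x) = sets M"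
  using kernel by (auto simp: jump_kernel_def)

lemma space_kernel: "x \<in> space M \<Longrightarrow> space (r x) = space M"
  using sets_kernel by (rule sets_eq_imp_space_eq)

lemma finite_kernel: "x \<in> space M \<Longrightarrow> finite_measure (r x)"
  using kernel by (intro finite_measureI) (auto simp: jump_kernel_def space_kernel)

lemma emeasure_kernel_measurable: "D \<in> sets M \<Longrightarrow> (\<lambda>x. emeasure (r x) D) \<in> borel_measurable M"
  using kernel by (auto simp: jump_kernel_def)

text \<open>The masses of the kernel are finite but not uniformly bounded, so measurability is taken
  from the theory of subprobability kernels after dividing by the total mass, which is positive and
  finite and is multiplied back afterwards.\<close>

lemma nn_integral_kernel_measurable [measurable (raw)]:
  assumes f: "(\<lambda>(z, y). f z y) \<in> borel_measurable (N \<Otimes>\<^sub>M M)" and h [measurable]: "h \<in> measurable N M"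
  shows "(\<lambda>z. \<integral>\<^sup>+y. f z y \<partial>r (h z)) \<in> borel_measurable N"
proof -
  define m where "m x = emeasure (r x) (space M)" for x
  define P where "P x = scale_measure (1 / m x) (r x)" for x
  have m: "0 < m x" "m x < \<infinity>" if "x \<in> space M" for x
    using kernel that by (auto simp: jump_kernel_def m_def)
  have m_meas [measurable]: "m \<in> borel_measurable M"
    unfolding m_def[abs_def] by (rule emeasure_kernel_measurable) simp
  have "P \<in> measurable M (subprob_algebra M)"
  proof (rule measurable_subprob_algebra)
    fix x assume x: "x \<in> space M"
    then show "sets (P x) = sets M" by (simp add: P_def sets_kernel)
    have "emeasure (P x) (space (P x)) = 1 / m x * m x"
      using x by (simp add: P_def space_scale_measure space_kernel m_def)
    also have "\<dots> = 1"
      using m[OF x] by (simp add: ennreal_divide_times ennreal_divide_self)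
    finally show "subprob_space (P x)"
      by (intro prob_space_imp_subprob_space prob_spaceI)
  next
    fix D assume D: "D \<in> sets M"
    note [measurable] = emeasure_kernel_measurable[OF D]
    show "(\<lambda>x. emeasure (P x) D) \<in> borel_measurable M"
      unfolding P_def by simp
  qed
  then have [measurable]: "(\<lambda>z. P (h z)) \<in> measurable N (subprob_algebra M)"
    by measurable
  have "(\<lambda>z. \<integral>\<^sup>+y. f z y \<partial>P (h z)) \<in> borel_measurable N"
    by (rule nn_integral_measurable_subprob_algebra2[where N=M]) (use f in measurable)
  then have "(\<lambda>z. m (h z) * (\<integral>\<^sup>+y. f z y \<partial>P (h z))) \<in> borel_measurable N"
    by measurable
  moreover have "m (h z) * (\<integral>\<^sup>+y. f z y \<partial>P (h z)) = (\<integral>\<^sup>+y. f z y \<partial>r (h z))" if z: "z \<in> space N" for z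
  proof -
    have hz: "h z \<in> space M" using measurable_space[OF h z] .
    have [measurable]: "f z \<in> borel_measurable (r (h z))"
      using measurable_Pair2[OF f z] sets_kernel[OF hz] by (simp cong: measurable_cong_sets)
    have "m (h z) * (\<integral>\<^sup>+y. f z y \<partial>P (h z)) = (m (h z) * (1 / m (h z))) * (\<integral>\<^sup>+y. f z y \<partial>r (h z))"
      by (simp add: P_def nn_integral_scale_measure mult.assoc)
    also have "m (h z) * (1 / m (h z)) = 1"
      using m[OF hz] by (simp add: ennreal_times_divide ennreal_divide_self)
    finally show ?thesis by simp
  qed
  ultimately show ?thesis
    by (simp cong: measurable_cong)
qed

section \<open>Total jump rate of the tilted kernel\<close>

definition rate :: "real \<Rightarrow> real \<Rightarrow> 'a \<Rightarrow> real" where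
  "rate c u x = enn2real (\<integral>\<^sup>+y. ennreal (exp (c * G u x y)) \<partial>r x)"

lemma rate_bounds:
  assumes x: "x \<in> space M"
  shows "ennreal (rate c u x) = (\<integral>\<^sup>+y. ennreal (exp (c * G u x y)) \<partial>r x)"
    and "exp (- (\<bar>c\<bar> * B)) * measure (r x) (space M) \<le> rate c u x"
    and "rate c u x \<le> exp (\<bar>c\<bar> * B) * measure (r x) (space M)"
proof -
  interpret finite_measure "r x" by (rule finite_kernel[OF x])
  have cG: "\<bar>c * G u x y\<bar> \<le> \<bar>c\<bar> * B" if "y \<in> space M" for y
    using G_bounded[OF x that] by (simp add: abs_mult mult_left_mono)
  have const: "(\<integral>\<^sup>+y. ennreal (exp b) \<partial>r x) = ennreal (exp b * measure (r x) (space M))" for b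
    using x by (simp add: space_kernel emeasure_eq_measure ennreal_mult)
  have upper: "(\<integral>\<^sup>+y. ennreal (exp (c * G u x y)) \<partial>r x) \<le> ennreal (exp (\<bar>c\<bar> * B) * measure (r x) (space M))"
    unfolding const[symmetric] using x cG by (intro nn_integral_mono) (force simp: space_kernel)
  have lower: "ennreal (exp (- (\<bar>c\<bar> * B)) * measure (r x) (space M)) \<le> (\<integral>\<^sup>+y. ennreal (exp (c * G u x y)) \<partial>r x)"
    unfolding const[symmetric] using x cG by (intro nn_integral_mono) (force simp: space_kernel)
  show eq: "ennreal (rate c u x) = (\<integral>\<^sup>+y. ennreal (exp (c * G u x y)) \<partial>r x)"
    unfolding rate_def using upper by (simp add: order_le_less_trans)
  show "exp (- (\<bar>c\<bar> * B)) * measure (r x) (space M) \<le> rate c u x"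
    using lower unfolding eq[symmetric] by (simp add: rate_def ennreal_le_iff)
  show "rate c u x \<le> exp (\<bar>c\<bar> * B) * measure (r x) (space M)"
    using upper unfolding eq[symmetric] by (simp add: ennreal_le_iff)
qed

lemma measure_kernel_pos:
  assumes "x \<in> space M"
  shows "0 < measure (r x) (space M)"
proof -
  have "0 < emeasure (r x) (space M)" "emeasure (r x) (space M) < \<infinity>"
    using kernel assms by (auto simp: jump_kernel_def)
  then show ?thesis by (simp add: measure_def enn2real_positive_iff)
qed

lemma rate_measurable_raw [measurable (raw)]:
  assumes [measurable]: "u \<in> borel_measurable N" "x \<in> measurable N M"
  shows "(\<lambda>z. rate c (u z) (x z)) \<in> borel_measurable N"
  unfolding rate_def by measurable

lemma bounded_rate_rate:
  assumes x: "x \<in> space M"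
  shows "bounded_rate (\<lambda>u. rate c u x)
    (exp (- (\<bar>c\<bar> * B)) * measure (r x) (space M)) (exp (\<bar>c\<bar> * B) * measure (r x) (space M))"
proof
  have "(\<lambda>u. x) \<in> measurable borel M" using x by simp
  then show "(\<lambda>u. rate c u x) \<in> borel_measurable borel" by measurable
qed (use rate_bounds[OF x] measure_kernel_pos[OF x] in auto)

lemma rate_pos: "x \<in> space M \<Longrightarrow> 0 < rate c u x"
  using bounded_rate.rate_pos[OF bounded_rate_rate] .

section \<open>Survival function and law of the next jump time\<close>

definition survival :: "real \<Rightarrow> real \<Rightarrow> 'a \<Rightarrow> real \<Rightarrow> real" where
  "survival c s x u = exp (- cumulative_rate (\<lambda>w. rate c w x) s u)"

lemma survival_measurable [measurable (raw)]:
  assumes [measurable]: "s \<in> borel_measurable N" "x \<in> measurable N M" "u \<in> borel_measurable N"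
  shows "(\<lambda>z. survival c (s z) (x z) (u z)) \<in> borel_measurable N"
  unfolding survival_def by measurable

lemma survival_nonneg [simp]: "0 \<le> survival c s x u"
  by (simp add: survival_def)

text \<open>This is the law of the absolute time of the next jump, not of the waiting time counted
  from the arrival at \<open>s\<close>.\<close>

definition holding_law :: "real \<Rightarrow> real \<Rightarrow> 'a \<Rightarrow> real measure" where
  "holding_law c s x = density lborel (\<lambda>u. ennreal (rate c u x * survival c s x u) * indicator {s<..} u)"

lemma emeasure_holding_law:
  assumes x: "x \<in> space M"
  shows "emeasure (holding_law c s x) {u<..} = ennreal (if u < s then 1 else survival c s x u)"
proof -
  interpret bounded_rate "\<lambda>u. rate c u x"
    "exp (- (\<bar>c\<bar> * B)) * measure (r x) (space M)" "exp (\<bar>c\<bar> * B) * measure (r x) (space M)"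
    by (rule bounded_rate_rate[OF x])
  have [measurable]: "(\<lambda>u. x) \<in> measurable borel M" using x by simp
  have "emeasure (holding_law c s x) {u<..}
      = (\<integral>\<^sup>+v. (ennreal (rate c v x * survival c s x v) * indicator {s<..} v) * indicator {u<..} v \<partial>lborel)"
    unfolding holding_law_def by (rule emeasure_density) auto
  also have "\<dots> = (\<integral>\<^sup>+v. ennreal (rate c v x * survival c s x v) * indicator {max s u<..} v \<partial>lborel)"
    by (intro nn_integral_cong) (auto split: split_indicator)
  \<comment> \<open>Using \<open>max s u\<close> treats both cases at once: for \<open>u < s\<close>
    it gives survival from \<open>s\<close> to \<open>s\<close>, which is 1.\<close>
  also have "\<dots> = ennreal (survival c s x (max s u))"
    unfolding survival_def by (rule nn_integral_rate_exp_cumulative_tail) simp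
  also have "survival c s x (max s u) = (if u < s then 1 else survival c s x u)"
    by (auto simp: survival_def max_def cumulative_rate_self)
  finally show ?thesis .
qed

section \<open>Open half-lines as an intersection-stable generator\<close>

lemma borel_sets_greaterThan: "sets (borel :: real measure) = sigma_sets UNIV (range greaterThan)"
  by (simp add: borel_Ioi)

lemma UN_greaterThan_nat: "(\<Union>n. {- real n<..}) = UNIV"
proof -
  have "\<exists>n. - real n < x" for x
    using reals_Archimedean2[of "- x"] by (auto simp: minus_less_iff)
  then show ?thesis by auto
qed

lemma Int_stable_greaterThan: "Int_stable (range (greaterThan :: real \<Rightarrow> _))"
proof (rule Int_stableI)
  fix a b :: "real set" assume "a \<in> range greaterThan" "b \<in> range greaterThan"
  then obtain u v where "a = {u<..}" "b = {v<..}" by auto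
  then have "a \<inter> b = {max u v<..}" by auto
  then show "a \<inter> b \<in> range greaterThan" by simp
qed

lemma prob_space_holding_law:
  assumes x: "x \<in> space M"
  shows "prob_space (holding_law c s x)"
proof
  interpret bounded_rate "\<lambda>u. rate c u x"
    "exp (- (\<bar>c\<bar> * B)) * measure (r x) (space M)" "exp (\<bar>c\<bar> * B) * measure (r x) (space M)"
    by (rule bounded_rate_rate[OF x])
  have [measurable]: "(\<lambda>u. x) \<in> measurable borel M" using x by simp
  have "emeasure (holding_law c s x) (space (holding_law c s x))
      = (\<integral>\<^sup>+v. ennreal (rate c v x * survival c s x v) * indicator {s<..} v \<partial>lborel)"
    unfolding holding_law_def by (simp add: emeasure_density)
  also have "\<dots> = 1"
    unfolding survival_def by (subst nn_integral_rate_exp_cumulative_tail) (simp_all add: cumulative_rate_self)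
  finally show "emeasure (holding_law c s x) (space (holding_law c s x)) = 1" .
qed

lemma holding_law_measurable [measurable (raw)]:
  assumes [measurable]: "s \<in> borel_measurable N" and x [measurable]: "x \<in> measurable N M"
  shows "(\<lambda>z. holding_law c (s z) (x z)) \<in> measurable N (prob_algebra borel)"
proof (rule measurable_prob_algebra_generated[OF borel_sets_greaterThan])
  show "Int_stable (range (greaterThan :: real \<Rightarrow> _))" by (rule Int_stable_greaterThan)
  fix z assume z: "z \<in> space N"
  show "prob_space (holding_law c (s z) (x z))" "sets (holding_law c (s z) (x z)) = sets borel"
    using prob_space_holding_law[OF measurable_space[OF x z]] by (auto simp: holding_law_def)
next
  fix A :: "real set" assume "A \<in> range greaterThan"
  then obtain u where A: "A = {u<..}" by auto
  have "(\<lambda>z. emeasure (holding_law c (s z) (x z)) A) \<in> borel_measurable N \<longleftrightarrow>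
      (\<lambda>z. ennreal (if u < s z then 1 else survival c (s z) (x z) u)) \<in> borel_measurable N"
    unfolding A by (intro measurable_cong emeasure_holding_law measurable_space[OF x])
  then show "(\<lambda>z. emeasure (holding_law c (s z) (x z)) A) \<in> borel_measurable N"
    by simp
qed simp

section \<open>Law of the jump destination\<close>

definition jump_law :: "real \<Rightarrow> real \<Rightarrow> 'a \<Rightarrow> 'a measure" where
  "jump_law c u x = density (r x) (\<lambda>y. ennreal (exp (c * G u x y) / rate c u x))"

lemma borel_measurable_kernel: "x \<in> space M \<Longrightarrow> f \<in> borel_measurable M \<Longrightarrow> f \<in> borel_measurable (r x)"
  by (subst measurable_cong_sets[OF sets_kernel refl])

lemma G_section_measurable:
  assumes x: "x \<in> space M"
  shows "(\<lambda>y. G u x y) \<in> borel_measurable M"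
proof -
  have "(\<lambda>y. (u, x, y)) \<in> measurable M (borel \<Otimes>\<^sub>M M \<Otimes>\<^sub>M M)"
    by (rule measurable_compose[OF measurable_Pair1'[OF x] measurable_Pair1']) simp
  from measurable_compose[OF this G_measurable] show ?thesis by (simp only: prod.case)
qed

lemma jump_density_measurable:
  assumes x: "x \<in> space M"
  shows "(\<lambda>y. ennreal (exp (c * G u x y) / a)) \<in> borel_measurable (r x)"
    and "(\<lambda>y. ennreal (exp (c * G u x y))) \<in> borel_measurable (r x)"
proof -
  note [measurable] = borel_measurable_kernel[OF x G_section_measurable[OF x]]
  show "(\<lambda>y. ennreal (exp (c * G u x y) / a)) \<in> borel_measurable (r x)"
    "(\<lambda>y. ennreal (exp (c * G u x y))) \<in> borel_measurable (r x)"
    by measurable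
qed

text \<open>The rate in the density of the holding law cancels the normalisation of the destination
  law. One-step formulas therefore involve only the survival function and the unnormalised tilted
  kernel.\<close>

lemma nn_integral_jump_law:
  assumes x: "x \<in> space M" and f: "f \<in> borel_measurable M"
  shows "ennreal (rate c u x) * (\<integral>\<^sup>+y. f y \<partial>jump_law c u x) = (\<integral>\<^sup>+y. ennreal (exp (c * G u x y)) * f y \<partial>r x)"
proof -
  note f' = borel_measurable_kernel[OF x f] and p = jump_density_measurable(1)[OF x, of c u "rate c u x"]
  have "ennreal (rate c u x) * (\<integral>\<^sup>+y. f y \<partial>jump_law c u x)
      = (\<integral>\<^sup>+y. ennreal (rate c u x) * (ennreal (exp (c * G u x y) / rate c u x) * f y) \<partial>r x)"
    unfolding jump_law_def nn_integral_density[OF p f']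
    by (rule nn_integral_cmult[symmetric, OF borel_measurable_times_ennreal[OF p f']])
  also have "\<dots> = (\<integral>\<^sup>+y. ennreal (exp (c * G u x y)) * f y \<partial>r x)"
  proof (rule nn_integral_cong)
    fix y
    have "ennreal (rate c u x) * ennreal (exp (c * G u x y) / rate c u x) = ennreal (exp (c * G u x y))"
      using rate_pos[OF x, of c u] by (subst ennreal_mult[symmetric]) simp_all
    then show "ennreal (rate c u x) * (ennreal (exp (c * G u x y) / rate c u x) * f y)
        = ennreal (exp (c * G u x y)) * f y"
      by (simp only: mult.assoc[symmetric])
  qed
  finally show ?thesis .
qed

lemma prob_space_jump_law:
  assumes x: "x \<in> space M"
  shows "prob_space (jump_law c u x)"
proof
  have "ennreal (rate c u x) * emeasure (jump_law c u x) (space (jump_law c u x)) = ennreal (rate c u x) * 1"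
    using nn_integral_jump_law[OF x, of "\<lambda>_. 1" c u] rate_bounds(1)[OF x, of c u] by simp
  then show "emeasure (jump_law c u x) (space (jump_law c u x)) = 1"
    using rate_pos[OF x, of c u] by (subst (asm) ennreal_mult_cancel_left) auto
qed

lemma emeasure_jump_law:
  assumes x: "x \<in> space M" and D: "D \<in> sets M"
  shows "emeasure (jump_law c u x) D = (\<integral>\<^sup>+y. ennreal (exp (c * G u x y) / rate c u x) * indicator D y \<partial>r x)"
  unfolding jump_law_def by (rule emeasure_density[OF jump_density_measurable(1)[OF x]]) (simp add: sets_kernel[OF x] D)

lemma jump_law_measurable [measurable (raw)]:
  assumes [measurable]: "u \<in> borel_measurable N" and x [measurable]: "x \<in> measurable N M"
  shows "(\<lambda>z. jump_law c (u z) (x z)) \<in> measurable N (prob_algebra M)"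
proof (rule measurable_prob_algebraI[OF prob_space_jump_law measurable_subprob_algebra])
  fix z assume z: "z \<in> space N"
  then show xz: "x z \<in> space M" by (rule measurable_space[OF x])
  show "subprob_space (jump_law c (u z) (x z))"
    by (rule prob_space_imp_subprob_space[OF prob_space_jump_law[OF xz]])
  show "sets (jump_law c (u z) (x z)) = sets M"
    using xz by (simp add: jump_law_def sets_kernel)
next
  fix D assume D [measurable]: "D \<in> sets M"
  have "(\<lambda>z. emeasure (jump_law c (u z) (x z)) D) \<in> borel_measurable N \<longleftrightarrow>
      (\<lambda>z. \<integral>\<^sup>+y. ennreal (exp (c * G (u z) (x z) y) / rate c (u z) (x z)) * indicator D y \<partial>r (x z)) \<in> borel_measurable N"
    by (intro measurable_cong emeasure_jump_law measurable_space[OF x] D)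
  also have \<dots> by measurable
  finally show "(\<lambda>z. emeasure (jump_law c (u z) (x z)) D) \<in> borel_measurable N" .
qed

text \<open>Processes are specified by unnormalised rate measures; splitting such a measure into
  total rate and destination law links that specification to \<open>survival\<close> and
  \<open>jump_law\<close>.\<close>

lemma tilted_kernel:
  assumes x: "x \<in> space M"
  shows total_rate_tilted: "total_rate M (density (r x) (\<lambda>y. ennreal (exp (c * G u x y)))) = rate c u x"
    and measure_tilted: "D \<in> sets M \<Longrightarrow> measure (density (r x) (\<lambda>y. ennreal (exp (c * G u x y)))) D
      = rate c u x * measure (jump_law c u x) D"
proof -
  interpret prob_space "jump_law c u x" by (rule prob_space_jump_law[OF x])
  have emeasure: "emeasure (density (r x) (\<lambda>y. ennreal (exp (c * G u x y)))) A
      = ennreal (rate c u x) * emeasure (jump_law c u x) A" if A: "A \<in> sets M" for A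
  proof -
    have "A \<in> sets (r x)" "A \<in> sets (jump_law c u x)"
      using A x by (simp_all add: jump_law_def sets_kernel)
    then show ?thesis
      using nn_integral_jump_law[OF x borel_measurable_indicator[OF A], of c u]
      by (simp only: emeasure_density[OF jump_density_measurable(2)[OF x, of c u]] nn_integral_indicator)
  qed
  show measure: "measure (density (r x) (\<lambda>y. ennreal (exp (c * G u x y)))) D
      = rate c u x * measure (jump_law c u x) D" if "D \<in> sets M" for D
    using rate_pos[OF x, of c u] by (simp add: measure_def emeasure[OF that] enn2real_mult)
  have "space M = space (jump_law c u x)"
    using x by (simp add: jump_law_def space_kernel)
  then show "total_rate M (density (r x) (\<lambda>y. ennreal (exp (c * G u x y)))) = rate c u x"
    using measure[OF sets.top] prob_space by (simp add: total_rate_def)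
qed

lemma measure_jump_law:
  assumes x: "x \<in> space M" and D: "D \<in> sets M"
  shows "measure (density (r x) (\<lambda>y. ennreal (exp (c * G u x y)))) D /
    total_rate M (density (r x) (\<lambda>y. ennreal (exp (c * G u x y)))) = measure (jump_law c u x) D"
  using rate_pos[OF x, of c u] by (simp add: total_rate_tilted[OF x] measure_tilted[OF x D])

end

section \<open>The one-step law of a jump process\<close>

lemma past_coordinate_measurable:
  assumes "\<And>i. T i \<in> borel_measurable \<Omega>" "\<And>i. Y i \<in> measurable \<Omega> M" "i \<le> n"
  shows "T i \<in> borel_measurable (past \<Omega> M T Y n)" "Y i \<in> measurable (past \<Omega> M T Y n) M"
proof -
  let ?P = "Pi\<^sub>M {..n} (\<lambda>_. borel \<Otimes>\<^sub>M M)" and ?H = "\<lambda>\<omega>. \<lambda>i\<in>{..n}. (T i \<omega>, Y i \<omega>)"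
  have "?H \<in> space \<Omega> \<rightarrow> space ?P"
    by (simp add: Pi_iff space_PiM restrict_PiE_iff space_pair_measure measurable_space[OF assms(2)])
  then have H: "?H \<in> measurable (past \<Omega> M T Y n) ?P"
    unfolding past_def by (rule measurable_vimage_algebra1)
  have "(\<lambda>p. p i) \<in> measurable ?P (borel \<Otimes>\<^sub>M M)"
    using assms(3) by (intro measurable_component_singleton) simp
  from measurable_compose[OF H this] have *: "(\<lambda>\<omega>. (T i \<omega>, Y i \<omega>)) \<in> measurable (past \<Omega> M T Y n) (borel \<Otimes>\<^sub>M M)"
    using assms(3) by simp
  show "T i \<in> borel_measurable (past \<Omega> M T Y n)"
    using measurable_compose[OF * measurable_fst] by simp
  show "Y i \<in> measurable (past \<Omega> M T Y n) M"
    using measurable_compose[OF * measurable_snd] by simp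
qed

lemma subalgebra_past:
  assumes [measurable]: "\<And>i. T i \<in> borel_measurable \<Omega>" "\<And>i. Y i \<in> measurable \<Omega> M"
  shows "subalgebra \<Omega> (past \<Omega> M T Y n)"
proof -
  have "(\<lambda>\<omega>. \<lambda>i\<in>{..n}. (T i \<omega>, Y i \<omega>)) \<in> measurable \<Omega> (Pi\<^sub>M {..n} (\<lambda>_. borel \<Otimes>\<^sub>M M))"
    by measurable
  from sets_image_in_sets[OF refl this] show ?thesis
    by (simp add: past_def subalgebra_def)
qed

text \<open>Measurability of the identity map says that \<open>past_next_time\<close> refines
  \<open>past\<close>; in this form it transfers measurability by composition.\<close>

lemma past_next_time_measurable:
  assumes TY: "\<And>i. T i \<in> borel_measurable \<Omega>" "\<And>i. Y i \<in> measurable \<Omega> M"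
  shows "T (Suc n) \<in> borel_measurable (past_next_time \<Omega> M T Y n)"
    and "(\<lambda>\<omega>. \<omega>) \<in> measurable (past_next_time \<Omega> M T Y n) (past \<Omega> M T Y n)"
proof -
  let ?P = "Pi\<^sub>M {..n} (\<lambda>_. borel \<Otimes>\<^sub>M M)" and ?H = "\<lambda>\<omega>. \<lambda>i\<in>{..n}. (T i \<omega>, Y i \<omega>)"
  have H_space: "?H \<in> space \<Omega> \<rightarrow> space ?P"
    by (simp add: Pi_iff space_PiM restrict_PiE_iff space_pair_measure measurable_space[OF TY(2)])
  then have "(\<lambda>\<omega>. (?H \<omega>, T (Suc n) \<omega>)) \<in> space \<Omega> \<rightarrow> space (?P \<Otimes>\<^sub>M borel)"
    by (auto simp: space_pair_measure)
  then have *: "(\<lambda>\<omega>. (?H \<omega>, T (Suc n) \<omega>)) \<in> measurable (past_next_time \<Omega> M T Y n) (?P \<Otimes>\<^sub>M borel)"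
    unfolding past_next_time_def by (rule measurable_vimage_algebra1)
  show "T (Suc n) \<in> borel_measurable (past_next_time \<Omega> M T Y n)"
    using measurable_compose[OF * measurable_snd] by simp
  have "?H \<in> measurable (past_next_time \<Omega> M T Y n) ?P"
    using measurable_compose[OF * measurable_fst] by simp
  moreover have "(\<lambda>\<omega>. \<omega>) \<in> space (past_next_time \<Omega> M T Y n) \<rightarrow> space \<Omega>"
    by (simp add: past_next_time_def)
  ultimately show "(\<lambda>\<omega>. \<omega>) \<in> measurable (past_next_time \<Omega> M T Y n) (past \<Omega> M T Y n)"
    unfolding past_def[of \<Omega> M T Y n] by (rule measurable_vimage_algebra2[rotated])
qed

lemma subalgebra_past_next_time:
  assumes [measurable]: "\<And>i. T i \<in> borel_measurable \<Omega>" "\<And>i. Y i \<in> measurable \<Omega> M"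
  shows "subalgebra \<Omega> (past_next_time \<Omega> M T Y n)"
proof -
  have "(\<lambda>\<omega>. (\<lambda>i\<in>{..n}. (T i \<omega>, Y i \<omega>), T (Suc n) \<omega>))
      \<in> measurable \<Omega> (Pi\<^sub>M {..n} (\<lambda>_. borel \<Otimes>\<^sub>M M) \<Otimes>\<^sub>M borel)"
    by measurable
  from sets_image_in_sets[OF refl this] show ?thesis
    by (simp add: past_next_time_def subalgebra_def)
qed

text \<open>Abstract \<open>S\<close> and \<open>q\<close> let one locale serve both processes, with
  tilt 0 and with tilt \<lambda>. They are compared only where the definition of a jump process sees
  them: \<open>S\<close> from the arrival time on, \<open>q\<close> after normalisation.\<close>

locale perturbed_jump_process = bounded_perturbation M r G B
  for M :: "'a measure" and r G B +
  fixes \<Omega> :: "'w measure" and \<nu> :: "'a measure" and S q T Y and c :: real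
  assumes process: "jump_process \<Omega> M \<nu> S q T Y"
    and S_eq: "\<And>s x u. x \<in> space M \<Longrightarrow> s \<le> u \<Longrightarrow> S s x u = survival c s x u"
    and q_eq: "\<And>u x D. x \<in> space M \<Longrightarrow> D \<in> sets M \<Longrightarrow>
      measure (q u x) D / total_rate M (q u x) = measure (jump_law c u x) D"
begin

sublocale prob_space \<Omega>
  using process by (simp add: jump_process_def)

lemma T_measurable [measurable]: "T n \<in> borel_measurable \<Omega>"
  using process by (simp add: jump_process_def)

lemma Y_measurable [measurable]: "Y n \<in> measurable \<Omega> M"
  using process by (simp add: jump_process_def)

lemma Y_space: "\<omega> \<in> space \<Omega> \<Longrightarrow> Y n \<omega> \<in> space M"
  using measurable_space[OF Y_measurable] .

lemma space_past: "space (past \<Omega> M T Y n) = space \<Omega>"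
  by (simp add: past_def)

text \<open>Two disintegrations: the destination given the past and the next jump time, then the
  next jump time given the past. The dependence on the past stays inside \<open>f\<close>, which
  lets weights accumulated along the path pass through.\<close>

lemma nn_integral_step:
  assumes f: "(\<lambda>(\<omega>, u, y). f \<omega> u y) \<in> borel_measurable (past \<Omega> M T Y n \<Otimes>\<^sub>M borel \<Otimes>\<^sub>M M)"
  shows "(\<integral>\<^sup>+\<omega>. f \<omega> (T (Suc n) \<omega>) (Y (Suc n) \<omega>) \<partial>\<Omega>) =
    (\<integral>\<^sup>+\<omega>. \<integral>\<^sup>+u. ennreal (survival c (T n \<omega>) (Y n \<omega>) u) * indicator {T n \<omega><..} u *
      (\<integral>\<^sup>+y. ennreal (exp (c * G u (Y n \<omega>) y)) * f \<omega> u y \<partial>r (Y n \<omega>)) \<partial>lborel \<partial>\<Omega>)"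
proof -
  let ?F = "past \<Omega> M T Y n" and ?F' = "past_next_time \<Omega> M T Y n"
  have f_raw [measurable (raw)]: "(\<lambda>z. f (a z) (b z) (d z)) \<in> borel_measurable N"
    if "a \<in> measurable N ?F" "b \<in> borel_measurable N" "d \<in> measurable N M" for a b d and N :: "'z measure"
  proof -
    have "(\<lambda>z. (a z, b z, d z)) \<in> measurable N (?F \<Otimes>\<^sub>M borel \<Otimes>\<^sub>M M)"
      by (intro measurable_Pair that)
    from measurable_compose[OF this f] show ?thesis by simp
  qed
  note past [measurable] = past_coordinate_measurable[where T=T and Y=Y and n=n and i=n, OF T_measurable Y_measurable order_refl]
  note next_time [measurable] = past_next_time_measurable[of T \<Omega> Y M n, OF T_measurable Y_measurable]
  have [measurable]: "Y n \<in> measurable ?F' M"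
    using measurable_compose[OF next_time(2) past(2)] .
  have "(\<integral>\<^sup>+\<omega>. f \<omega> (T (Suc n) \<omega>) (Y (Suc n) \<omega>) \<partial>\<Omega>)
      = (\<integral>\<^sup>+\<omega>. (\<lambda>(\<omega>, y). f \<omega> (T (Suc n) \<omega>) y) (\<omega>, Y (Suc n) \<omega>) \<partial>\<Omega>)"
    by simp
  \<comment> \<open>Destinations are integrated out first, since their conditional law uses the
    finer sigma-algebra that already contains the next jump time.\<close>
  also have "\<dots> = (\<integral>\<^sup>+\<omega>. \<integral>\<^sup>+y. (\<lambda>(\<omega>, y). f \<omega> (T (Suc n) \<omega>) y) (\<omega>, y) \<partial>jump_law c (T (Suc n) \<omega>) (Y n \<omega>) \<partial>\<Omega>)"
  proof (rule nn_integral_conditional_kernel[where G="sets M" and A="\<lambda>_. space M" and N=M])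
    show "subalgebra \<Omega> ?F'"
      by (rule subalgebra_past_next_time[OF T_measurable Y_measurable])
    show "(\<lambda>\<omega>. jump_law c (T (Suc n) \<omega>) (Y n \<omega>)) \<in> measurable ?F' (prob_algebra M)"
      by measurable
    show "(\<lambda>(\<omega>, y). f \<omega> (T (Suc n) \<omega>) y) \<in> borel_measurable (?F' \<Otimes>\<^sub>M M)"
      by measurable
    fix D assume D: "D \<in> sets M"
    have "AE \<omega> in \<Omega>. real_cond_exp \<Omega> ?F' (indicator {\<omega>'\<in>space \<Omega>. Y (Suc n) \<omega>' \<in> D}) \<omega> =
          measure (q (T (Suc n) \<omega>) (Y n \<omega>)) D / total_rate M (q (T (Suc n) \<omega>) (Y n \<omega>))"
      using process D by (simp add: jump_process_def)
    then show "AE \<omega> in \<Omega>. real_cond_exp \<Omega> ?F' (indicator {\<omega>'\<in>space \<Omega>. Y (Suc n) \<omega>' \<in> D}) \<omega> =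
        measure (jump_law c (T (Suc n) \<omega>) (Y n \<omega>)) D"
      by (rule AE_mp) (simp add: q_eq[OF Y_space D])
  qed (auto simp: Int_stable_def sets.space_closed sets.sigma_sets_eq)
  also have "\<dots> = (\<integral>\<^sup>+\<omega>. (\<lambda>(\<omega>, u). \<integral>\<^sup>+y. f \<omega> u y \<partial>jump_law c u (Y n \<omega>)) (\<omega>, T (Suc n) \<omega>) \<partial>\<Omega>)"
    by simp
  \<comment> \<open>The remaining integrand depends on the past and the jump time only, so the
    coarser sigma-algebra and the tails of the jump time take over.\<close>
  also have "\<dots> = (\<integral>\<^sup>+\<omega>. \<integral>\<^sup>+u. (\<lambda>(\<omega>, u). \<integral>\<^sup>+y. f \<omega> u y \<partial>jump_law c u (Y n \<omega>)) (\<omega>, u) \<partial>holding_law c (T n \<omega>) (Y n \<omega>) \<partial>\<Omega>)"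
  proof (rule nn_integral_conditional_kernel[where G="range greaterThan" and A="\<lambda>i. {- real i<..}" and N=borel])
    show "subalgebra \<Omega> ?F"
      by (rule subalgebra_past[OF T_measurable Y_measurable])
    show "(\<lambda>\<omega>. holding_law c (T n \<omega>) (Y n \<omega>)) \<in> measurable ?F (prob_algebra borel)"
      by measurable
    have [measurable]: "(\<lambda>z. jump_law c (snd z) (Y n (fst z))) \<in> measurable (?F \<Otimes>\<^sub>M borel) (subprob_algebra M)"
      by (rule measurable_prob_algebraD) measurable
    have "(\<lambda>z. \<integral>\<^sup>+y. f (fst z) (snd z) y \<partial>jump_law c (snd z) (Y n (fst z))) \<in> borel_measurable (?F \<Otimes>\<^sub>M borel)"
      by (rule nn_integral_measurable_subprob_algebra2[where N=M]) measurable
    then show "(\<lambda>(\<omega>, u). \<integral>\<^sup>+y. f \<omega> u y \<partial>jump_law c u (Y n \<omega>)) \<in> borel_measurable (?F \<Otimes>\<^sub>M borel)"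
      by (simp add: split_beta')
    show "Int_stable (range (greaterThan :: real \<Rightarrow> _))" by (rule Int_stable_greaterThan)
    show "sets borel = sigma_sets (space borel) (range (greaterThan :: real \<Rightarrow> _))"
      by (simp add: borel_sets_greaterThan)
    show "(\<Union>i. {- real i<..}) = space borel"
      by (simp add: UN_greaterThan_nat)
    fix D :: "real set" assume "D \<in> range greaterThan"
    then obtain u where D: "D = {u<..}" by auto
    have "AE \<omega> in \<Omega>. real_cond_exp \<Omega> ?F (indicator {\<omega>'\<in>space \<Omega>. T (Suc n) \<omega>' > u}) \<omega> =
          (if u < T n \<omega> then 1 else S (T n \<omega>) (Y n \<omega>) u)"
      using process by (simp add: jump_process_def)
    then show "AE \<omega> in \<Omega>. real_cond_exp \<Omega> ?F (indicator {\<omega>'\<in>space \<Omega>. T (Suc n) \<omega>' \<in> D}) \<omega> =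
        measure (holding_law c (T n \<omega>) (Y n \<omega>)) D"
      unfolding D greaterThan_iff
      by (rule AE_mp) (auto intro!: AE_I2 simp: measure_def emeasure_holding_law[OF Y_space] S_eq[OF Y_space])
  qed auto
  also have "\<dots> = (\<integral>\<^sup>+\<omega>. \<integral>\<^sup>+u. ennreal (survival c (T n \<omega>) (Y n \<omega>) u) * indicator {T n \<omega><..} u *
      (\<integral>\<^sup>+y. ennreal (exp (c * G u (Y n \<omega>) y)) * f \<omega> u y \<partial>r (Y n \<omega>)) \<partial>lborel \<partial>\<Omega>)"
  proof (rule nn_integral_cong)
    fix \<omega> assume \<omega>: "\<omega> \<in> space \<Omega>"
    note x = Y_space[OF \<omega>, of n]
    have x_const [measurable]: "(\<lambda>_. Y n \<omega>) \<in> measurable borel M" using x by simp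
    have \<omega>_const: "(\<lambda>_. \<omega>) \<in> measurable M ?F" "(\<lambda>_. \<omega>) \<in> measurable borel ?F" "(\<lambda>_. \<omega>) \<in> measurable (borel \<Otimes>\<^sub>M M) ?F"
      using \<omega> by (auto simp: space_past)
    have f_sec: "(\<lambda>y. f \<omega> u y) \<in> borel_measurable M" for u
      by (rule f_raw[OF \<omega>_const(1)]) simp_all
    have [measurable]: "(\<lambda>u. jump_law c u (Y n \<omega>)) \<in> measurable borel (subprob_algebra M)"
      by (rule measurable_prob_algebraD) measurable
    have m1 [measurable]: "(\<lambda>u. \<integral>\<^sup>+y. f \<omega> u y \<partial>jump_law c u (Y n \<omega>)) \<in> borel_measurable borel"
      by (rule nn_integral_measurable_subprob_algebra2[where N=M])
         (simp_all add: split_beta' f_raw[OF \<omega>_const(3)])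
    have m2: "(\<lambda>u. ennreal (rate c u (Y n \<omega>) * survival c (T n \<omega>) (Y n \<omega>) u) * indicator {T n \<omega><..} u) \<in> borel_measurable lborel"
      by measurable
    have "(\<integral>\<^sup>+u. (\<integral>\<^sup>+y. f \<omega> u y \<partial>jump_law c u (Y n \<omega>)) \<partial>holding_law c (T n \<omega>) (Y n \<omega>))
      = (\<integral>\<^sup>+u. ennreal (rate c u (Y n \<omega>) * survival c (T n \<omega>) (Y n \<omega>) u) * indicator {T n \<omega><..} u *
          (\<integral>\<^sup>+y. f \<omega> u y \<partial>jump_law c u (Y n \<omega>)) \<partial>lborel)"
      unfolding holding_law_def by (rule nn_integral_density[OF m2]) simp
    also have "\<dots> = (\<integral>\<^sup>+u. ennreal (survival c (T n \<omega>) (Y n \<omega>) u) * indicator {T n \<omega><..} u *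
      (\<integral>\<^sup>+y. ennreal (exp (c * G u (Y n \<omega>) y)) * f \<omega> u y \<partial>r (Y n \<omega>)) \<partial>lborel)"
    proof (rule nn_integral_cong)
      fix u
      show "ennreal (rate c u (Y n \<omega>) * survival c (T n \<omega>) (Y n \<omega>) u) * indicator {T n \<omega><..} u *
          (\<integral>\<^sup>+y. f \<omega> u y \<partial>jump_law c u (Y n \<omega>)) =
        ennreal (survival c (T n \<omega>) (Y n \<omega>) u) * indicator {T n \<omega><..} u *
          (\<integral>\<^sup>+y. ennreal (exp (c * G u (Y n \<omega>) y)) * f \<omega> u y \<partial>r (Y n \<omega>))"
        unfolding nn_integral_jump_law[OF x f_sec, symmetric]
        using rate_pos[OF x, of c u] by (simp add: ennreal_mult mult_ac)
    qed
    finally show "(\<integral>\<^sup>+u. (\<lambda>(\<omega>, u). \<integral>\<^sup>+y. f \<omega> u y \<partial>jump_law c u (Y n \<omega>)) (\<omega>, u) \<partial>holding_law c (T n \<omega>) (Y n \<omega>)) =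
      (\<integral>\<^sup>+u. ennreal (survival c (T n \<omega>) (Y n \<omega>) u) * indicator {T n \<omega><..} u *
      (\<integral>\<^sup>+y. ennreal (exp (c * G u (Y n \<omega>) y)) * f \<omega> u y \<partial>r (Y n \<omega>)) \<partial>lborel)"
      by simp
  qed
  finally show ?thesis .
qed

text \<open>Monotonicity of the jump times is not postulated in \<open>jump_process\<close> and must
  be extracted from the conditional tails. The one-step formula is applied to the indicator of a
  jump at or before \<open>T n\<close>, where the holding density vanishes.\<close>

lemma AE_T_strict_mono: "AE \<omega> in \<Omega>. \<forall>n. T n \<omega> < T (Suc n) \<omega>"
proof (unfold AE_all_countable, rule allI)
  fix n
  let ?A = "{\<omega>\<in>space \<Omega>. T (Suc n) \<omega> \<le> T n \<omega>}"
  note [measurable] = past_coordinate_measurable[where T=T and Y=Y and n=n and i=n, OF T_measurable Y_measurable order_refl]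
  have "emeasure \<Omega> ?A = (\<integral>\<^sup>+\<omega>. indicator ?A \<omega> \<partial>\<Omega>)"
    by (rule nn_integral_indicator[symmetric]) measurable
  also have "\<dots> = (\<integral>\<^sup>+\<omega>. (if T (Suc n) \<omega> \<le> T n \<omega> then 1 else 0) \<partial>\<Omega>)"
    by (intro nn_integral_cong) (simp add: indicator_def)
  also have "\<dots> = (\<integral>\<^sup>+\<omega>. \<integral>\<^sup>+u. ennreal (survival c (T n \<omega>) (Y n \<omega>) u) * indicator {T n \<omega><..} u *
      (\<integral>\<^sup>+y. ennreal (exp (c * G u (Y n \<omega>) y)) * (if u \<le> T n \<omega> then 1 else 0) \<partial>r (Y n \<omega>)) \<partial>lborel \<partial>\<Omega>)"
    by (rule nn_integral_step) measurable
  also have "\<dots> = (\<integral>\<^sup>+\<omega>. \<integral>\<^sup>+u. 0 \<partial>(lborel :: real measure) \<partial>\<Omega>)"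
    by (intro nn_integral_cong) (auto split: split_indicator)
  finally have "emeasure \<Omega> ?A = 0" by simp
  then show "AE \<omega> in \<Omega>. T n \<omega> < T (Suc n) \<omega>"
    by (intro AE_I[where N="?A"]) auto
qed

end

section \<open>Backward recursions for the tilted process\<close>

lemma ennreal_mult_distrib:
  assumes "0 \<le> p" "0 \<le> b" "0 \<le> d"
  shows "ennreal p * (ennreal b * w + ennreal d * v) = ennreal (p * b) * w + ennreal (p * d) * v"
  by (simp only: distrib_left ennreal_mult[OF assms(1,2)] ennreal_mult[OF assms(1,3)] mult.assoc)

context bounded_perturbation
begin

text \<open>The real-valued form of \<open>abs_rate\<close>; no value is lost, because
  \<open>G\<close> is bounded and \<open>r x\<close> is finite.\<close>

definition abs_mean :: "real \<Rightarrow> 'a \<Rightarrow> real" where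
  "abs_mean u x = enn2real (\<integral>\<^sup>+y. ennreal \<bar>G u x y\<bar> \<partial>r x)"

lemma abs_mean_measurable_raw [measurable (raw)]:
  assumes [measurable]: "u \<in> borel_measurable N" "x \<in> measurable N M"
  shows "(\<lambda>z. abs_mean (u z) (x z)) \<in> borel_measurable N"
  unfolding abs_mean_def by measurable

lemma abs_mean_nonneg [simp]: "0 \<le> abs_mean u x"
  by (simp add: abs_mean_def)

lemma abs_mean_bounds:
  assumes x: "x \<in> space M"
  shows "ennreal (abs_mean u x) = (\<integral>\<^sup>+y. ennreal \<bar>G u x y\<bar> \<partial>r x)"
    and "abs_mean u x \<le> B * measure (r x) (space M)"
proof -
  interpret finite_measure "r x" by (rule finite_kernel[OF x])
  have B: "0 \<le> B" using G_bounded[OF x x, of 0] by simp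
  have "(\<integral>\<^sup>+y. ennreal \<bar>G u x y\<bar> \<partial>r x) \<le> (\<integral>\<^sup>+y. ennreal B \<partial>r x)"
    using G_bounded[OF x] by (intro nn_integral_mono ennreal_leI) (auto simp: space_kernel[OF x])
  also have "\<dots> = ennreal (B * measure (r x) (space M))"
    using x B by (simp add: space_kernel emeasure_eq_measure ennreal_mult)
  finally have upper: "(\<integral>\<^sup>+y. ennreal \<bar>G u x y\<bar> \<partial>r x) \<le> ennreal (B * measure (r x) (space M))" .
  then show eq: "ennreal (abs_mean u x) = (\<integral>\<^sup>+y. ennreal \<bar>G u x y\<bar> \<partial>r x)"
    unfolding abs_mean_def by (simp add: order_le_less_trans)
  show "abs_mean u x \<le> B * measure (r x) (space M)"
    using upper B unfolding eq[symmetric] by (simp add: ennreal_le_iff)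
qed

lemma abs_mean_section_measurable:
  assumes x: "x \<in> space M"
  shows "(\<lambda>u. abs_mean u x) \<in> borel_measurable borel"
  by (rule abs_mean_measurable_raw) (simp_all add: x)

lemma abs_mean_integrable: "x \<in> space M \<Longrightarrow> set_integrable lborel {s..u} (\<lambda>w. abs_mean w x)"
  using abs_mean_bounds(2)
  by (intro set_integrable_bounded_Icc[where C="B * measure (r x) (space M)"] abs_mean_section_measurable) simp_all

lemma ennreal_cumulative_abs_mean:
  assumes "x \<in> space M"
  shows "ennreal (cumulative_rate (\<lambda>w. abs_mean w x) s u)
    = (\<integral>\<^sup>+w. ennreal (abs_mean w x) * indicator {s..u} w \<partial>lborel)"
  using assms
  by (intro ennreal_cumulative[where C="B * measure (r x) (space M)"] abs_mean_section_measurable abs_mean_bounds(2)) simp_all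

text \<open>For a process of tilt \<open>c\<close> that has just entered \<open>x\<close> at time
  \<open>s\<close>, this is the expectation of exp(a times the time integral of \<open>|G|_r\<close>
  up to the \<open>k\<close>-th further jump) on the event that this jump occurs by time
  \<open>t\<close>. With \<open>a = 0\<close> it is the probability of that event. The recursion
  runs over the first jump and refers to no probability space.\<close>

primrec backward :: "real \<Rightarrow> real \<Rightarrow> real \<Rightarrow> nat \<Rightarrow> real \<Rightarrow> 'a \<Rightarrow> ennreal" where
  "backward c a t 0 s x = 1"
| "backward c a t (Suc k) s x =
    (\<integral>\<^sup>+u. ennreal (survival c s x u * exp (a * cumulative_rate (\<lambda>w. abs_mean w x) s u)) * indicator {s<..t} u *
      (\<integral>\<^sup>+y. ennreal (exp (c * G u x y)) * backward c a t k u y \<partial>r x) \<partial>lborel)"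

lemma backward_measurable_pair: "(\<lambda>(s, x). backward c a t k s x) \<in> borel_measurable (borel \<Otimes>\<^sub>M M)"
proof (induction k)
  case (Suc k)
  have [measurable (raw)]: "(\<lambda>z. backward c a t k (u z) (y z)) \<in> borel_measurable N"
    if "u \<in> borel_measurable N" "y \<in> measurable N M" for u y and N :: "'z measure"
    using measurable_compose[OF measurable_Pair[OF that] Suc] by simp
  have [measurable]: "(\<lambda>w. abs_mean (fst w) (snd w)) \<in> borel_measurable (borel \<Otimes>\<^sub>M M)"
    by measurable
  have [measurable (raw)]: "(\<lambda>z. indicator {s z<..t} (u z) :: ennreal) \<in> borel_measurable N"
    if [measurable]: "s \<in> borel_measurable N" "u \<in> borel_measurable N" for s u and N :: "'z measure"
    unfolding indicator_def greaterThanAtMost_iff by measurable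
  show ?case
    by simp measurable
qed simp

lemma backward_measurable [measurable (raw)]:
  assumes "s \<in> borel_measurable N" "x \<in> measurable N M"
  shows "(\<lambda>z. backward c a t k (s z) (x z)) \<in> borel_measurable N"
  using measurable_compose[OF measurable_Pair[OF assms] backward_measurable_pair] by simp

text \<open>Pointwise in time, r(2c) - 2 r(c) + r(0) is the integral of (exp(c G) - 1)^2 against
  \<open>r x\<close>, hence at most a times \<open>|G|_r\<close>. All terms are kept with positive
  sign so that the computation can run in the extended nonnegative reals. Exponentiating gives the
  one-step form of the relation between the densities.\<close>

lemma cumulative_rate_convexity:
  assumes x: "x \<in> space M" and a: "0 \<le> a"
    and le: "\<And>u y. y \<in> space M \<Longrightarrow> (exp (c * G u x y) - 1)\<^sup>2 \<le> a * \<bar>G u x y\<bar>"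
  shows "cumulative_rate (\<lambda>w. rate (2 * c) w x) s u + cumulative_rate (\<lambda>w. rate 0 w x) s u
    \<le> 2 * cumulative_rate (\<lambda>w. rate c w x) s u + a * cumulative_rate (\<lambda>w. abs_mean w x) s u"
proof -
  have pointwise: "rate (2 * c) w x + rate 0 w x \<le> 2 * rate c w x + a * abs_mean w x" for w
  proof -
    note [measurable] = jump_density_measurable(2)[OF x] borel_measurable_kernel[OF x G_section_measurable[OF x]]
    have "ennreal (rate (2 * c) w x + rate 0 w x)
        = (\<integral>\<^sup>+y. ennreal (exp (2 * c * G w x y)) + ennreal (exp (0 * G w x y)) \<partial>r x)"
      using rate_pos[OF x, of "2 * c" w] rate_pos[OF x, of 0 w]
      by (simp add: ennreal_plus rate_bounds(1)[OF x] nn_integral_add)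
    also have "\<dots> \<le> (\<integral>\<^sup>+y. ennreal 2 * ennreal (exp (c * G w x y)) + ennreal a * ennreal \<bar>G w x y\<bar> \<partial>r x)"
    proof (rule nn_integral_mono)
      fix y assume "y \<in> space (r x)"
      then have "(exp (c * G w x y) - 1)\<^sup>2 \<le> a * \<bar>G w x y\<bar>"
        using le x by (simp add: space_kernel)
      moreover have "exp (2 * c * G w x y) = (exp (c * G w x y))\<^sup>2"
        by (simp add: exp_double[symmetric] mult.assoc)
      ultimately have "exp (2 * c * G w x y) + exp (0 * G w x y) \<le> 2 * exp (c * G w x y) + a * \<bar>G w x y\<bar>"
        by (simp add: power2_diff)
      then have "ennreal (exp (2 * c * G w x y) + exp (0 * G w x y))
          \<le> ennreal (2 * exp (c * G w x y) + a * \<bar>G w x y\<bar>)"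
        by (rule ennreal_leI)
      then show "ennreal (exp (2 * c * G w x y)) + ennreal (exp (0 * G w x y))
          \<le> ennreal 2 * ennreal (exp (c * G w x y)) + ennreal a * ennreal \<bar>G w x y\<bar>"
        using a by (simp add: ennreal_plus ennreal_mult del: ennreal_numeral)
    qed
    also have "\<dots> = ennreal 2 * ennreal (rate c w x) + ennreal a * ennreal (abs_mean w x)"
      by (simp add: nn_integral_add nn_integral_cmult rate_bounds(1)[OF x] abs_mean_bounds(1)[OF x])
    also have "\<dots> = ennreal (2 * rate c w x + a * abs_mean w x)"
      using a rate_pos[OF x, of c w] by (simp add: ennreal_plus ennreal_mult del: ennreal_numeral)
    finally show ?thesis
      using a rate_pos[OF x, of c w] by (subst (asm) ennreal_le_iff) simp_all
  qed
  note int = bounded_rate.rate_integrable[OF bounded_rate_rate[OF x]] abs_mean_integrable[OF x]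
  have "(LINT w:{s..u}|lborel. rate (2 * c) w x + rate 0 w x)
      \<le> (LINT w:{s..u}|lborel. 2 * rate c w x + a * abs_mean w x)"
    using int pointwise by (intro set_integral_mono) auto
  then show ?thesis
    using int by (simp add: cumulative_rate_def set_integral_add)
qed

text \<open>Used with tilt 2c: the first jump of that tilt, restricted to times up to
  \<open>t\<close>, carries mass at most 1, and this is all that is ever required of the doubled
  tilt.\<close>

lemma survival_total_mass:
  assumes x: "x \<in> space M"
  shows "(\<integral>\<^sup>+u. ennreal (survival c s x u) * indicator {s<..t} u * ennreal (rate c u x) \<partial>lborel) \<le> 1"
proof -
  have "(\<integral>\<^sup>+u. ennreal (survival c s x u) * indicator {s<..t} u * ennreal (rate c u x) \<partial>lborel)
      \<le> (\<integral>\<^sup>+u. ennreal (rate c u x * exp (- cumulative_rate (\<lambda>w. rate c w x) s u)) * indicator {s<..} u \<partial>lborel)"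
    using rate_pos[OF x]
    by (intro nn_integral_mono)
       (auto simp: survival_def ennreal_mult less_imp_le mult.commute split: split_indicator)
  also have "\<dots> = 1"
    by (rule bounded_rate.nn_integral_rate_exp_cumulative[OF bounded_rate_rate[OF x]])
  finally show ?thesis .
qed

text \<open>
  This is the elementary inequality \<open>\<surd>(w v) \<le> \<delta> w + v / (4 \<delta>)\<close>, applied to the squared density of the
  perturbed law: \<open>w\<close> is the density of the law with parameter \<open>2 c\<close>, of total mass at most \<open>1\<close>.
  The induction only works since \<open>\<delta>\<close> may depend on the first jump.
\<close>

lemma backward_le:
  assumes a: "0 \<le> a"
    and le: "\<And>u x y. x \<in> space M \<Longrightarrow> y \<in> space M \<Longrightarrow> (exp (c * G u x y) - 1)\<^sup>2 \<le> a * \<bar>G u x y\<bar>"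
    and "x \<in> space M" "0 < \<delta>"
  shows "backward c 0 t k s x \<le> ennreal \<delta> + ennreal (1 / (4 * \<delta>)) * backward 0 a t k s x"
  using assms(3,4)
proof (induction k arbitrary: s x \<delta>)
  case 0
  \<comment> \<open>Without jumps both densities are 1, and the claim is \<delta> + 1 / (4\<delta>)
    \<ge> 1, which is this square divided by 4\<delta>.\<close>
  have "0 \<le> (2 * \<delta> - 1)\<^sup>2" by simp
  then have "1 \<le> \<delta> + 1 / (4 * \<delta>)"
    using \<open>0 < \<delta>\<close> by (simp add: field_simps power2_eq_square)
  then have "ennreal 1 \<le> ennreal (\<delta> + 1 / (4 * \<delta>))" by (rule ennreal_leI)
  then show ?case using \<open>0 < \<delta>\<close> by simp
next
  case (Suc k)
  note x = \<open>x \<in> space M\<close> and \<delta> = \<open>0 < \<delta>\<close>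
  have x_const [measurable]: "(\<lambda>_. x) \<in> measurable borel M" using x by simp
  note [measurable] = jump_density_measurable(2)[OF x]
  let ?A = "\<lambda>u. exp (a * cumulative_rate (\<lambda>w. abs_mean w x) s u)"
  let ?v = "\<lambda>u. \<integral>\<^sup>+y. ennreal (exp (0 * G u x y)) * backward 0 a t k u y \<partial>r x"
  have backward_section: "(\<lambda>y. backward 0 a t k u y) \<in> borel_measurable (r x)" for u
    by (rule borel_measurable_kernel[OF x]) measurable
  have step: "ennreal (survival c s x u) * (\<integral>\<^sup>+y. ennreal (exp (c * G u x y)) * backward c 0 t k u y \<partial>r x)
      \<le> ennreal \<delta> * (ennreal (survival (2 * c) s x u) * ennreal (rate (2 * c) u x)) +
        ennreal (1 / (4 * \<delta>)) * (ennreal (survival 0 s x u * ?A u) * ?v u)" for u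
  proof -
    define p where "p = survival c s x u"
    define p2 where "p2 = survival (2 * c) s x u"
    have m1: "(\<lambda>y. ennreal (exp (2 * c * G u x y))) \<in> borel_measurable (r x)"
      by (rule jump_density_measurable(2)[OF x])
    have m2: "(\<lambda>y. ennreal (exp (0 * G u x y)) * backward 0 a t k u y) \<in> borel_measurable (r x)"
      by (rule borel_measurable_times_ennreal[OF jump_density_measurable(2)[OF x] backward_section])
    have pos: "0 < p" "0 < p2" by (simp_all add: p_def p2_def survival_def)
    \<comment> \<open>Squared survival against the survivals of tilts 2c and 0 and the exponential
      weight; the jump factors match exactly, as e^2 is the factor of tilt 2c.\<close>
    have "p\<^sup>2 \<le> p2 * (survival 0 s x u * ?A u)"
      using cumulative_rate_convexity[OF x a le[OF x], of s u]
      by (simp add: p_def p2_def survival_def exp_double[symmetric] exp_add[symmetric] del: exp_add)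
    then have ratio: "p\<^sup>2 / p2 \<le> survival 0 s x u * ?A u"
      using pos by (simp add: field_simps)
    have "(\<integral>\<^sup>+y. ennreal (exp (c * G u x y)) * backward c 0 t k u y \<partial>r x)
      \<le> (\<integral>\<^sup>+y. ennreal (\<delta> * p2 / p) * ennreal (exp (2 * c * G u x y)) +
           ennreal (p / (4 * \<delta> * p2)) * (ennreal (exp (0 * G u x y)) * backward 0 a t k u y) \<partial>r x)"
    proof (rule nn_integral_mono)
      fix y assume "y \<in> space (r x)"
      then have y: "y \<in> space M" using x by (simp add: space_kernel)
      define e where "e = exp (c * G u x y)"
      have e: "0 < e" "exp (2 * c * G u x y) = e * e"
        by (simp_all add: e_def exp_add[symmetric])
      \<comment> \<open>The new parameter is \<delta> times e p2 / p, the ratio of the one-step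
        densities e^2 p2 (tilt 2c) and e p (tilt c). After multiplication by e p the first term
        becomes \<delta> e^2 p2, a step of tilt 2c, and the second p^2 / (4 \<delta> p2), free of
        the jump factor and bounded by \<open>ratio\<close>.\<close>
      have "ennreal e * backward c 0 t k u y
          \<le> ennreal e * (ennreal (\<delta> * e * p2 / p) + ennreal (1 / (4 * (\<delta> * e * p2 / p))) * backward 0 a t k u y)"
        using Suc.IH[OF y, of "\<delta> * e * p2 / p" u] \<delta> pos e by (intro mult_left_mono) simp_all
      also have "\<dots> = ennreal (e * (\<delta> * e * p2 / p)) + ennreal (e * (1 / (4 * (\<delta> * e * p2 / p)))) * backward 0 a t k u y"
        using ennreal_mult_distrib[of e "\<delta> * e * p2 / p" "1 / (4 * (\<delta> * e * p2 / p))" 1 "backward 0 a t k u y"] \<delta> pos e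
        by simp
      also have "e * (\<delta> * e * p2 / p) = \<delta> * p2 / p * (e * e)" by simp
      also have "e * (1 / (4 * (\<delta> * e * p2 / p))) = p / (4 * \<delta> * p2)"
        using \<delta> pos e(1) by (simp add: field_simps)
      also have "ennreal (\<delta> * p2 / p * (e * e)) = ennreal (\<delta> * p2 / p) * ennreal (e * e)"
        using \<delta> pos e(1) by (intro ennreal_mult) simp_all
      finally show "ennreal (exp (c * G u x y)) * backward c 0 t k u y
          \<le> ennreal (\<delta> * p2 / p) * ennreal (exp (2 * c * G u x y)) +
            ennreal (p / (4 * \<delta> * p2)) * (ennreal (exp (0 * G u x y)) * backward 0 a t k u y)"
        unfolding e(2) by (simp add: e_def)
    qed
    also have "\<dots> = ennreal (\<delta> * p2 / p) * ennreal (rate (2 * c) u x) + ennreal (p / (4 * \<delta> * p2)) * ?v u"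
      by (simp only: nn_integral_add[OF borel_measurable_times_ennreal[OF borel_measurable_const m1]
          borel_measurable_times_ennreal[OF borel_measurable_const m2]]
        nn_integral_cmult[OF m1] nn_integral_cmult[OF m2] rate_bounds(1)[OF x])
    finally have "ennreal p * (\<integral>\<^sup>+y. ennreal (exp (c * G u x y)) * backward c 0 t k u y \<partial>r x)
        \<le> ennreal p * (ennreal (\<delta> * p2 / p) * ennreal (rate (2 * c) u x) + ennreal (p / (4 * \<delta> * p2)) * ?v u)"
      by (rule mult_left_mono) simp
    also have "\<dots> = ennreal (p * (\<delta> * p2 / p)) * ennreal (rate (2 * c) u x) + ennreal (p * (p / (4 * \<delta> * p2))) * ?v u"
      using \<delta> pos by (intro ennreal_mult_distrib) simp_all
    also have "\<dots> = ennreal (\<delta> * p2) * ennreal (rate (2 * c) u x) + ennreal (1 / (4 * \<delta>) * (p\<^sup>2 / p2)) * ?v u"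
      using pos(1) by (simp add: power2_eq_square)
    also have "\<dots> \<le> ennreal (\<delta> * p2) * ennreal (rate (2 * c) u x)
        + ennreal (1 / (4 * \<delta>) * (survival 0 s x u * ?A u)) * ?v u"
      using \<delta> ratio by (intro add_left_mono mult_right_mono ennreal_leI mult_left_mono) simp_all
    also have "ennreal (\<delta> * p2) = ennreal \<delta> * ennreal p2"
      using \<delta> pos by (intro ennreal_mult) simp_all
    also have "ennreal (1 / (4 * \<delta>) * (survival 0 s x u * ?A u)) = ennreal (1 / (4 * \<delta>)) * ennreal (survival 0 s x u * ?A u)"
      using \<delta> by (intro ennreal_mult) simp_all
    finally show ?thesis
      by (simp only: p_def p2_def mult.assoc)
  qed
  have "backward c 0 t (Suc k) s x
      \<le> (\<integral>\<^sup>+u. ennreal \<delta> * (ennreal (survival (2 * c) s x u) * indicator {s<..t} u * ennreal (rate (2 * c) u x)) +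
        ennreal (1 / (4 * \<delta>)) * (ennreal (survival 0 s x u * ?A u) * indicator {s<..t} u * ?v u) \<partial>lborel)"
    unfolding backward.simps
  proof (rule nn_integral_mono)
    fix u
    show "ennreal (survival c s x u * exp (0 * cumulative_rate (\<lambda>w. abs_mean w x) s u)) * indicator {s<..t} u *
        (\<integral>\<^sup>+y. ennreal (exp (c * G u x y)) * backward c 0 t k u y \<partial>r x)
      \<le> ennreal \<delta> * (ennreal (survival (2 * c) s x u) * indicator {s<..t} u * ennreal (rate (2 * c) u x)) +
        ennreal (1 / (4 * \<delta>)) * (ennreal (survival 0 s x u * ?A u) * indicator {s<..t} u * ?v u)"
      using step[of u] by (cases "u \<in> {s<..t}") simp_all
  qed
  also have "\<dots> = ennreal \<delta> * (\<integral>\<^sup>+u. ennreal (survival (2 * c) s x u) * indicator {s<..t} u * ennreal (rate (2 * c) u x) \<partial>lborel)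
      + ennreal (1 / (4 * \<delta>)) * backward 0 a t (Suc k) s x"
  proof -
    have [measurable]: "(\<lambda>w. abs_mean (fst w) (snd w)) \<in> borel_measurable (borel \<Otimes>\<^sub>M M)"
      by measurable
    have m1: "(\<lambda>u. ennreal (survival (2 * c) s x u) * indicator {s<..t} u * ennreal (rate (2 * c) u x)) \<in> borel_measurable lborel"
      by measurable
    have m2: "(\<lambda>u. ennreal (survival 0 s x u * ?A u) * indicator {s<..t} u * ?v u) \<in> borel_measurable lborel"
      by measurable
    show ?thesis
      unfolding backward.simps by (simp only: nn_integral_add[OF borel_measurable_times_ennreal[OF borel_measurable_const m1]
          borel_measurable_times_ennreal[OF borel_measurable_const m2]]
        nn_integral_cmult[OF m1] nn_integral_cmult[OF m2])
  qed
  \<comment> \<open>The later jumps of tilt 2c were already bounded by the constant term of the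
    induction hypothesis, so only the mass of one step is left.\<close>
  also have "\<dots> \<le> ennreal \<delta> * 1 + ennreal (1 / (4 * \<delta>)) * backward 0 a t (Suc k) s x"
    by (intro add_right_mono mult_left_mono survival_total_mass[OF x]) simp
  finally show ?case by simp
qed

end

section \<open>The exponential weight along a path\<close>

lemma ennreal_exp_le_exp_ennreal:
  assumes "ennreal z \<le> I" "0 \<le> z"
  shows "ennreal (exp z) \<le> exp_ennreal I"
proof (cases "I = \<infinity>")
  case False
  then have "z \<le> enn2real I"
    using assms enn2real_mono[of "ennreal z" I] by (simp add: less_top)
  then show ?thesis
    using False by (simp add: exp_ennreal_def ennreal_leI)
qed (simp add: exp_ennreal_def)

lemma state_eq:
  assumes mono: "\<And>m n. m \<le> n \<Longrightarrow> T m \<omega> \<le> T n \<omega>" and "explosion_time T \<omega> = \<infinity>"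
    and s: "T k \<omega> \<le> s" "s < T (Suc k) \<omega>"
  shows "state T Y s \<omega> = Some (Y k \<omega>)"
proof -
  have "(LEAST n. s < T (Suc n) \<omega>) = k"
  proof (rule Least_equality)
    fix m assume m: "s < T (Suc m) \<omega>"
    show "k \<le> m"
    proof (rule ccontr)
      assume "\<not> k \<le> m"
      then have "T (Suc m) \<omega> \<le> T k \<omega>" by (intro mono) simp
      then show False using m s by simp
    qed
  qed (rule s(2))
  then show ?thesis
    using assms(2) by (simp add: state_def)
qed

text \<open>Half-open intervals between consecutive times are disjoint, so at most one summand is
  nonzero, and its interval lies in \<open>{0..t}\<close> because the last time is at most
  \<open>t\<close>.\<close>

lemma sum_indicator_consecutive:
  fixes \<tau> :: "nat \<Rightarrow> real" and f :: "nat \<Rightarrow> ennreal"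
  assumes mono: "\<And>m n. m \<le> n \<Longrightarrow> \<tau> m \<le> \<tau> n" and \<tau>: "0 \<le> \<tau> 0" "\<tau> n \<le> t"
    and F: "\<And>k. \<tau> k \<le> w \<Longrightarrow> w < \<tau> (Suc k) \<Longrightarrow> f k = F"
  shows "(\<Sum>k<n. f k * indicator {\<tau> k..<\<tau> (Suc k)} w) \<le> F * indicator {0..t} w"
proof (cases "\<exists>k<n. \<tau> k \<le> w \<and> w < \<tau> (Suc k)")
  case True
  then obtain k where k: "k < n" "\<tau> k \<le> w" "w < \<tau> (Suc k)" by auto
  have unique: "j = k" if "\<tau> j \<le> w" "w < \<tau> (Suc j)" for j
  proof (rule ccontr)
    assume "j \<noteq> k"
    then consider "Suc j \<le> k" | "Suc k \<le> j" by linarith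
    then show False
      using mono[of "Suc j" k] mono[of "Suc k" j] that k by cases linarith+
  qed
  have "(\<Sum>j<n. f j * indicator {\<tau> j..<\<tau> (Suc j)} w) = (\<Sum>j<n. if j = k then F else 0)"
  proof (rule sum.cong[OF refl])
    fix j
    show "f j * indicator {\<tau> j..<\<tau> (Suc j)} w = (if j = k then F else 0)"
    proof (cases "j = k")
      case True
      then show ?thesis using F[OF k(2,3)] k by simp
    next
      case False
      then have "w \<notin> {\<tau> j..<\<tau> (Suc j)}" using unique[of j] by auto
      then show ?thesis using False by simp
    qed
  qed
  also have "\<dots> = F" using k by simp
  finally show ?thesis
    using mono[of 0 k] mono[of "Suc k" n] \<tau> k by (simp add: indicator_def)
next
  case False
  then have "(\<Sum>j<n. f j * indicator {\<tau> j..<\<tau> (Suc j)} w) = 0"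
    by (auto simp: indicator_def)
  then show ?thesis by simp
qed

context perturbed_jump_process
begin

text \<open>The exponential of \<open>a\<close> times the time integral of \<open>|G|_r\<close>
  along the path up to \<open>T n\<close>, written as a sum over sojourns so that it involves only
  the first jumps and states.\<close>

definition weight :: "real \<Rightarrow> nat \<Rightarrow> 'w \<Rightarrow> real" where
  "weight a n \<omega> = exp (a * (\<Sum>k<n. cumulative_rate (\<lambda>w. abs_mean w (Y k \<omega>)) (T k \<omega>) (T (Suc k) \<omega>)))"

text \<open>\<open>N\<close> is general because both \<open>\<Omega>\<close> and \<open>past\<close>
  occur. The last time entering the sum is \<open>T n\<close>, so the weight is already known in the
  past up to \<open>n\<close>.\<close>

lemma weight_measurable:
  assumes Y: "\<And>k. k \<le> n \<Longrightarrow> Y k \<in> measurable N M" and T: "\<And>k. k \<le> n \<Longrightarrow> T k \<in> borel_measurable N"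
  shows "weight a n \<in> borel_measurable N"
proof -
  have [measurable]: "(\<lambda>w. abs_mean (fst w) (snd w)) \<in> borel_measurable (borel \<Otimes>\<^sub>M M)"
    by measurable
  have "(\<lambda>\<omega>. \<Sum>k<n. cumulative_rate (\<lambda>w. abs_mean w (Y k \<omega>)) (T k \<omega>) (T (Suc k) \<omega>)) \<in> borel_measurable N"
  proof (rule borel_measurable_sum)
    fix k assume "k \<in> {..<n}"
    then have [measurable]: "Y k \<in> measurable N M" "T k \<in> borel_measurable N" "T (Suc k) \<in> borel_measurable N"
      using Y T by auto
    show "(\<lambda>\<omega>. cumulative_rate (\<lambda>w. abs_mean w (Y k \<omega>)) (T k \<omega>) (T (Suc k) \<omega>)) \<in> borel_measurable N"
      by measurable
  qed
  then show ?thesis unfolding weight_def[abs_def] by measurable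
qed

lemma T_0: "\<omega> \<in> space \<Omega> \<Longrightarrow> T 0 \<omega> = 0"
  using process by (simp add: jump_process_def)

lemma distr_Y_0: "distr \<Omega> M (Y 0) = \<nu>"
  using process by (simp add: jump_process_def)

text \<open>One jump is traded: the weight of the last sojourn leaves the path and becomes the
  outermost layer of the recursion. This works because \<open>weight a (Suc n)\<close> is
  \<open>weight a n\<close>, known from the past, times a factor depending on the past and the next
  jump time.\<close>

lemma backward_step:
  "(\<integral>\<^sup>+\<omega>. ennreal (weight a (Suc n) \<omega>) * indicator {..t} (T (Suc n) \<omega>) *
      backward c a t k (T (Suc n) \<omega>) (Y (Suc n) \<omega>) \<partial>\<Omega>)
    = (\<integral>\<^sup>+\<omega>. ennreal (weight a n \<omega>) * indicator {..t} (T n \<omega>) * backward c a t (Suc k) (T n \<omega>) (Y n \<omega>) \<partial>\<Omega>)"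
proof -
  let ?F = "past \<Omega> M T Y n"
  let ?A = "\<lambda>\<omega> u. exp (a * cumulative_rate (\<lambda>w. abs_mean w (Y n \<omega>)) (T n \<omega>) u)"
  let ?f = "\<lambda>\<omega> u y. ennreal (weight a n \<omega> * ?A \<omega> u) * indicator {..t} u * backward c a t k u y"
  note past [measurable] = past_coordinate_measurable[where T=T and Y=Y and n=n, OF T_measurable Y_measurable]
  have [measurable]: "weight a n \<in> borel_measurable ?F"
    by (rule weight_measurable) (simp_all add: past)
  have [measurable]: "Y n \<in> measurable ?F M" "T n \<in> borel_measurable ?F"
    by (simp_all add: past)
  have [measurable]: "(\<lambda>w. abs_mean (fst w) (snd w)) \<in> borel_measurable (borel \<Otimes>\<^sub>M M)"
    by measurable
  have "(\<integral>\<^sup>+\<omega>. ennreal (weight a (Suc n) \<omega>) * indicator {..t} (T (Suc n) \<omega>) *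
      backward c a t k (T (Suc n) \<omega>) (Y (Suc n) \<omega>) \<partial>\<Omega>)
    = (\<integral>\<^sup>+\<omega>. ?f \<omega> (T (Suc n) \<omega>) (Y (Suc n) \<omega>) \<partial>\<Omega>)"
    by (simp add: weight_def distrib_left exp_add)
  also have "\<dots> = (\<integral>\<^sup>+\<omega>. \<integral>\<^sup>+u. ennreal (survival c (T n \<omega>) (Y n \<omega>) u) * indicator {T n \<omega><..} u *
      (\<integral>\<^sup>+y. ennreal (exp (c * G u (Y n \<omega>) y)) * ?f \<omega> u y \<partial>r (Y n \<omega>)) \<partial>lborel \<partial>\<Omega>)"
    by (rule nn_integral_step) measurable
  also have "\<dots> = (\<integral>\<^sup>+\<omega>. ennreal (weight a n \<omega>) * indicator {..t} (T n \<omega>) * backward c a t (Suc k) (T n \<omega>) (Y n \<omega>) \<partial>\<Omega>)"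
  proof (rule nn_integral_cong)
    fix \<omega> assume \<omega>: "\<omega> \<in> space \<Omega>"
    note x = Y_space[OF \<omega>, of n]
    have x_const [measurable]: "(\<lambda>_. Y n \<omega>) \<in> measurable borel M" using x by simp
    let ?h = "\<lambda>u y. ennreal (exp (c * G u (Y n \<omega>) y)) * backward c a t k u y"
    have h: "?h u \<in> borel_measurable (r (Y n \<omega>))" for u
      by (rule borel_measurable_times_ennreal[OF jump_density_measurable(2)[OF x] borel_measurable_kernel[OF x]]) measurable
    have H: "(\<lambda>u. \<integral>\<^sup>+y. ?h u y \<partial>r (Y n \<omega>)) \<in> borel_measurable borel"
      by measurable
    let ?k = "\<lambda>u. ennreal (survival c (T n \<omega>) (Y n \<omega>) u * ?A \<omega> u) * indicator {T n \<omega><..t} u *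
      (\<integral>\<^sup>+y. ?h u y \<partial>r (Y n \<omega>))"
    have K: "?k \<in> borel_measurable lborel"
      using H by measurable
    have "(\<integral>\<^sup>+u. ennreal (survival c (T n \<omega>) (Y n \<omega>) u) * indicator {T n \<omega><..} u *
        (\<integral>\<^sup>+y. ennreal (exp (c * G u (Y n \<omega>) y)) * ?f \<omega> u y \<partial>r (Y n \<omega>)) \<partial>lborel)
      = (\<integral>\<^sup>+u. ennreal (weight a n \<omega>) * ?k u \<partial>lborel)"
    proof (rule nn_integral_cong)
      fix u
      have "(\<integral>\<^sup>+y. ennreal (exp (c * G u (Y n \<omega>) y)) * ?f \<omega> u y \<partial>r (Y n \<omega>))
        = (\<integral>\<^sup>+y. (ennreal (weight a n \<omega> * ?A \<omega> u) * indicator {..t} u) * ?h u y \<partial>r (Y n \<omega>))"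
        by (intro nn_integral_cong) (simp only: mult_ac)
      also have "\<dots> = ennreal (weight a n \<omega> * ?A \<omega> u) * indicator {..t} u * (\<integral>\<^sup>+y. ?h u y \<partial>r (Y n \<omega>))"
        by (rule nn_integral_cmult[OF h])
      finally have inner: "(\<integral>\<^sup>+y. ennreal (exp (c * G u (Y n \<omega>) y)) * ?f \<omega> u y \<partial>r (Y n \<omega>))
        = ennreal (weight a n \<omega>) * ennreal (?A \<omega> u) * indicator {..t} u * (\<integral>\<^sup>+y. ?h u y \<partial>r (Y n \<omega>))"
        by (simp add: weight_def ennreal_mult)
      have ind: "indicator {T n \<omega><..} u * indicator {..t} u = (indicator {T n \<omega><..t} u :: ennreal)"
        by (auto simp: indicator_def)
      show "ennreal (survival c (T n \<omega>) (Y n \<omega>) u) * indicator {T n \<omega><..} u *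
          (\<integral>\<^sup>+y. ennreal (exp (c * G u (Y n \<omega>) y)) * ?f \<omega> u y \<partial>r (Y n \<omega>)) = ennreal (weight a n \<omega>) * ?k u"
        unfolding inner ind[symmetric] by (simp add: ennreal_mult mult_ac)
    qed
    also have "\<dots> = ennreal (weight a n \<omega>) * backward c a t (Suc k) (T n \<omega>) (Y n \<omega>)"
      unfolding backward.simps by (rule nn_integral_cmult[OF K])
    \<comment> \<open>The indicator can be inserted freely: for \<open>T n \<omega> > t\<close> the
      recursion integrates over an empty time interval.\<close>
    also have "\<dots> = ennreal (weight a n \<omega>) * indicator {..t} (T n \<omega>) * backward c a t (Suc k) (T n \<omega>) (Y n \<omega>)"
      by (cases "T n \<omega> \<le> t") (simp_all del: mult_eq_0_iff)
    finally show "(\<integral>\<^sup>+u. ennreal (survival c (T n \<omega>) (Y n \<omega>) u) * indicator {T n \<omega><..} u *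
        (\<integral>\<^sup>+y. ennreal (exp (c * G u (Y n \<omega>) y)) * ?f \<omega> u y \<partial>r (Y n \<omega>)) \<partial>lborel)
      = ennreal (weight a n \<omega>) * indicator {..t} (T n \<omega>) * backward c a t (Suc k) (T n \<omega>) (Y n \<omega>)" .
  qed
  finally show ?thesis .
qed

text \<open>The sum \<open>n + k\<close> is invariant under the trade, so \<open>k\<close> varies in
  the induction. At \<open>n = 0\<close> only the initial law is left, which frees the expectation
  from its probability space.\<close>

lemma nn_integral_weight_backward:
  assumes t: "0 \<le> t"
  shows "(\<integral>\<^sup>+\<omega>. ennreal (weight a n \<omega>) * indicator {..t} (T n \<omega>) * backward c a t k (T n \<omega>) (Y n \<omega>) \<partial>\<Omega>)
    = (\<integral>\<^sup>+x. backward c a t (n + k) 0 x \<partial>\<nu>)"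
proof (induction n arbitrary: k)
  case 0
  have "(\<lambda>x. backward c a t k 0 x) \<in> borel_measurable M" by measurable
  then have "(\<integral>\<^sup>+x. backward c a t k 0 x \<partial>\<nu>) = (\<integral>\<^sup>+\<omega>. backward c a t k 0 (Y 0 \<omega>) \<partial>\<Omega>)"
    unfolding distr_Y_0[symmetric] by (intro nn_integral_distr) auto
  also have "\<dots> = (\<integral>\<^sup>+\<omega>. ennreal (weight a 0 \<omega>) * indicator {..t} (T 0 \<omega>) * backward c a t k (T 0 \<omega>) (Y 0 \<omega>) \<partial>\<Omega>)"
    using t by (intro nn_integral_cong) (simp add: T_0 weight_def)
  finally show ?case by simp
next
  case (Suc n)
  show ?case
    using Suc[of "Suc k"] by (simp only: backward_step add_Suc add_Suc_right)
qed

lemma nn_integral_weight: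
  assumes "0 \<le> t"
  shows "(\<integral>\<^sup>+\<omega>. ennreal (weight a n \<omega>) * indicator {..t} (T n \<omega>) \<partial>\<Omega>) = (\<integral>\<^sup>+x. backward c a t n 0 x \<partial>\<nu>)"
  using nn_integral_weight_backward[OF assms, of a n 0] by simp

text \<open>If \<open>T n \<omega> \<le> t\<close>, the first \<open>n\<close> sojourns are disjoint
  parts of \<open>{0..t}\<close>, so the exponent of the weight is dominated by the time integral in
  Condition C.\<close>

lemma weight_le:
  assumes \<omega>: "\<omega> \<in> space \<Omega>" and mono: "\<And>m n. m \<le> n \<Longrightarrow> T m \<omega> \<le> T n \<omega>"
    and explosion: "explosion_time T \<omega> = \<infinity>" and n: "T n \<omega> \<le> t" and a: "0 \<le> a"
  shows "ennreal (weight a n \<omega>) \<le> exp_ennreal (ennreal a *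
    (\<integral>\<^sup>+s\<in>{0..t}. (case state T Y s \<omega> of None \<Rightarrow> 0 | Some x \<Rightarrow> abs_rate r G s x) \<partial>lborel))"
proof -
  let ?g = "\<lambda>s. case state T Y s \<omega> of None \<Rightarrow> 0 | Some x \<Rightarrow> abs_rate r G s x"
  let ?c = "\<lambda>k. cumulative_rate (\<lambda>w. abs_mean w (Y k \<omega>)) (T k \<omega>) (T (Suc k) \<omega>)"
  have nonneg: "0 \<le> ?c k" for k
    unfolding cumulative_rate_def set_lebesgue_integral_def by (rule integral_nonneg_AE) simp
  have m: "(\<lambda>w. ennreal (abs_mean w (Y k \<omega>))) \<in> borel_measurable lborel" for k
    using abs_mean_section_measurable[OF Y_space[OF \<omega>]] by simp
  have "ennreal (\<Sum>k<n. ?c k) = (\<Sum>k<n. ennreal (?c k))"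
    using nonneg by (simp add: sum_ennreal)
  also have "\<dots> = (\<Sum>k<n. \<integral>\<^sup>+w. ennreal (abs_mean w (Y k \<omega>)) * indicator {T k \<omega>..<T (Suc k) \<omega>} w \<partial>lborel)"
  proof (rule sum.cong[OF refl])
    fix k
    \<comment> \<open>Closed intervals become half-open, at the cost of one null point, to make
      consecutive sojourns disjoint.\<close>
    show "ennreal (?c k) = (\<integral>\<^sup>+w. ennreal (abs_mean w (Y k \<omega>)) * indicator {T k \<omega>..<T (Suc k) \<omega>} w \<partial>lborel)"
      unfolding ennreal_cumulative_abs_mean[OF Y_space[OF \<omega>]]
      by (rule nn_integral_cong_AE, rule AE_mp[OF AE_lborel_singleton[of "T (Suc k) \<omega>"]])
         (auto split: split_indicator)
  qed
  also have "\<dots> = (\<integral>\<^sup>+w. (\<Sum>k<n. ennreal (abs_mean w (Y k \<omega>)) * indicator {T k \<omega>..<T (Suc k) \<omega>} w) \<partial>lborel)"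
    by (rule nn_integral_sum[symmetric]) (intro borel_measurable_times_ennreal m borel_measurable_indicator, simp)
  also have "\<dots> \<le> (\<integral>\<^sup>+s. ?g s * indicator {0..t} s \<partial>lborel)"
  proof (rule nn_integral_mono)
    fix w
    show "(\<Sum>k<n. ennreal (abs_mean w (Y k \<omega>)) * indicator {T k \<omega>..<T (Suc k) \<omega>} w) \<le> ?g w * indicator {0..t} w"
    proof (rule sum_indicator_consecutive[OF mono])
      fix k assume "T k \<omega> \<le> w" "w < T (Suc k) \<omega>"
      then show "ennreal (abs_mean w (Y k \<omega>)) = ?g w"
        using state_eq[of T \<omega> k w Y, OF mono explosion]
        by (simp add: abs_rate_def abs_mean_bounds(1)[OF Y_space[OF \<omega>]])
    qed (use T_0[OF \<omega>] n in auto)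
  qed
  finally have "ennreal a * ennreal (\<Sum>k<n. ?c k) \<le> ennreal a * (\<integral>\<^sup>+s. ?g s * indicator {0..t} s \<partial>lborel)"
    by (rule mult_left_mono) simp
  then show ?thesis
    unfolding weight_def using a nonneg
    by (intro ennreal_exp_le_exp_ennreal mult_nonneg_nonneg sum_nonneg) (simp_all add: ennreal_mult sum_nonneg)
qed

text \<open>Without explosion, almost every path has some jump time beyond \<open>t\<close>, after
  which the indicator is 0; Condition C bounds all weights simultaneously before that.\<close>

lemma weight_tendsto_0:
  assumes explosion: "AE \<omega> in \<Omega>. explosion_time T \<omega> = \<infinity>"
    and condition: "condition_C \<Omega> r T Y t a G" and a: "0 \<le> a"
  shows "(\<lambda>n. \<integral>\<^sup>+\<omega>. ennreal (weight a n \<omega>) * indicator {..t} (T n \<omega>) \<partial>\<Omega>) \<longlonglongrightarrow> 0"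
proof -
  let ?u = "\<lambda>n \<omega>. ennreal (weight a n \<omega>) * indicator {..t} (T n \<omega>)"
  let ?F = "\<lambda>\<omega>. exp_ennreal (ennreal a *
    (\<integral>\<^sup>+s\<in>{0..t}. (case state T Y s \<omega> of None \<Rightarrow> 0 | Some x \<Rightarrow> abs_rate r G s x) \<partial>lborel))"
  have [measurable]: "weight a n \<in> borel_measurable \<Omega>" for n
    by (rule weight_measurable) simp_all
  have good: "AE \<omega> in \<Omega>. \<omega> \<in> space \<Omega> \<and> (\<forall>m n. m \<le> n \<longrightarrow> T m \<omega> \<le> T n \<omega>) \<and> explosion_time T \<omega> = \<infinity>"
    using AE_space AE_T_strict_mono explosion
  proof eventually_elim
    case (elim \<omega>)
    then show ?case using lift_Suc_mono_le[of "\<lambda>n. T n \<omega>"] less_imp_le by blast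
  qed
  have "(\<lambda>n. \<integral>\<^sup>+\<omega>. ?u n \<omega> \<partial>\<Omega>) \<longlonglongrightarrow> (\<integral>\<^sup>+\<omega>. 0 \<partial>\<Omega>)"
  \<comment> \<open>The dominating function is the supremum of the sequence, measurable as a
    countable supremum. It is compared with the exponential in Condition C by monotonicity of the
    integral alone, so measurability of \<open>state\<close> never comes up.\<close>
  proof (rule nn_integral_dominated_convergence[where w="\<lambda>\<omega>. SUP n. ?u n \<omega>"])
    show "(\<lambda>\<omega>. SUP n. ?u n \<omega>) \<in> borel_measurable \<Omega>"
      by measurable
    show "AE \<omega> in \<Omega>. ?u n \<omega> \<le> (SUP n. ?u n \<omega>)" for n
      by (intro AE_I2 SUP_upper) simp
    have "(\<integral>\<^sup>+\<omega>. (SUP n. ?u n \<omega>) \<partial>\<Omega>) \<le> (\<integral>\<^sup>+\<omega>. ?F \<omega> \<partial>\<Omega>)"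
    proof (rule nn_integral_mono_AE)
      show "AE \<omega> in \<Omega>. (SUP n. ?u n \<omega>) \<le> ?F \<omega>"
        using good
      proof eventually_elim
        case (elim \<omega>)
        show ?case
        proof (rule SUP_least)
          fix n
          show "?u n \<omega> \<le> ?F \<omega>"
            using weight_le[of \<omega> n t a] elim a by (cases "T n \<omega> \<le> t") simp_all
        qed
      qed
    qed
    also have "\<dots> < \<infinity>"
      using condition by (simp add: condition_C_def)
    finally show "(\<integral>\<^sup>+\<omega>. (SUP n. ?u n \<omega>) \<partial>\<Omega>) < \<infinity>" .
    show "AE \<omega> in \<Omega>. (\<lambda>n. ?u n \<omega>) \<longlonglongrightarrow> 0"
      using good
    proof eventually_elim
      case (elim \<omega>)
      then have "ereal t < (SUP n. ereal (T n \<omega>))" by (simp add: explosion_time_def)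
      then obtain m where "t < T m \<omega>" by (auto simp: less_SUP_iff)
      then have "?u n \<omega> = 0" if "m \<le> n" for n
      proof -
        have "T m \<omega> \<le> T n \<omega>" using elim that by blast
        then show ?thesis using \<open>t < T m \<omega>\<close> by simp
      qed
      then show ?case
        by (intro tendsto_eventually) (auto simp: eventually_sequentially)
    qed
  qed measurable
  then show ?thesis by simp
qed

end

section \<open>Nonexplosion\<close>

text \<open>From |exp z - 1| \<le> 2 |z| the square is at most 4 |z| |z|, and smallness of z bounds
  4 |z| by 1. This turns a quadratic quantity into the linear one that Condition C controls.\<close>

lemma exp_minus_one_square_le:
  fixes z :: real
  assumes "\<bar>z\<bar> \<le> 1 / 8"
  shows "(exp z - 1)\<^sup>2 \<le> \<bar>z\<bar>"
proof -
  have "exp z \<le> 1 + 2 * \<bar>z\<bar>" "1 + z \<le> exp z"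
    using exp_bound_lemma[of z] assms by simp_all
  then have "\<bar>exp z - 1\<bar> \<le> 2 * \<bar>z\<bar>" by linarith
  then have "(exp z - 1)\<^sup>2 \<le> (2 * \<bar>z\<bar>)\<^sup>2" by (intro abs_le_square_iff[THEN iffD1]) simp
  also have "\<dots> = 4 * \<bar>z\<bar> * \<bar>z\<bar>" by (simp add: power2_eq_square)
  also have "\<dots> \<le> 1 * \<bar>z\<bar>" using assms by (intro mult_right_mono) simp_all
  finally show ?thesis by simp
qed

lemma (in bounded_perturbation) perturbed_jump_processI:
  assumes "jump_process \<Omega> M \<nu> S q T Y"
    and "\<And>s x u. x \<in> space M \<Longrightarrow> s \<le> u \<Longrightarrow> S s x u = survival c s x u"
    and "\<And>u x. x \<in> space M \<Longrightarrow> q u x = density (r x) (\<lambda>y. ennreal (exp (c * G u x y)))"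
  shows "perturbed_jump_process M r G B \<Omega> \<nu> S q T Y c"
  using assms by unfold_locales (simp_all add: measure_jump_law)

text \<open>The explosion time is a supremum, so it exceeds \<open>t\<close> exactly when some jump
  time does. The complement lies in every event \<open>T n \<omega> \<le> t\<close>, hence has
  probability below every \<epsilon>.\<close>

lemma prob_explosion_time_gt:
  assumes "prob_space \<Omega>" and [measurable]: "\<And>n. T n \<in> borel_measurable \<Omega>"
    and lim: "\<And>\<epsilon>. 0 < \<epsilon> \<Longrightarrow> \<exists>n. emeasure \<Omega> {\<omega>\<in>space \<Omega>. T n \<omega> \<le> t} \<le> ennreal \<epsilon>"
  shows "measure \<Omega> {\<omega>\<in>space \<Omega>. explosion_time T \<omega> > ereal t} = 1"
proof -
  interpret prob_space \<Omega> by fact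
  let ?N = "{\<omega>\<in>space \<Omega>. \<forall>n. T n \<omega> \<le> t}"
  have "emeasure \<Omega> ?N \<le> 0"
  proof (rule ennreal_le_epsilon)
    fix \<epsilon> :: real assume "0 < \<epsilon>"
    then obtain n where n: "emeasure \<Omega> {\<omega>\<in>space \<Omega>. T n \<omega> \<le> t} \<le> ennreal \<epsilon>" using lim by blast
    have "emeasure \<Omega> ?N \<le> emeasure \<Omega> {\<omega>\<in>space \<Omega>. T n \<omega> \<le> t}" by (intro emeasure_mono) auto
    with n show "emeasure \<Omega> ?N \<le> 0 + ennreal \<epsilon>" by simp
  qed
  then have "AE \<omega> in \<Omega>. \<not> (\<forall>n. T n \<omega> \<le> t)"
    by (intro AE_I[where N="?N"]) auto
  moreover have "{\<omega>\<in>space \<Omega>. explosion_time T \<omega> > ereal t} = {\<omega>\<in>space \<Omega>. \<not> (\<forall>n. T n \<omega> \<le> t)}"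
    by (auto simp: explosion_time_def less_SUP_iff not_le)
  ultimately show ?thesis
    by (simp add: prob_Collect_eq_1)
qed

theorem theorem2p5:
  fixes M :: "'a measure" and \<nu> :: "'a measure" and r :: "'a \<Rightarrow> 'a measure"
    and \<Omega> :: "'w measure" and T :: "nat \<Rightarrow> 'w \<Rightarrow> real" and Y :: "nat \<Rightarrow> 'w \<Rightarrow> 'a"
    and \<Omega>' :: "'v measure" and T' :: "nat \<Rightarrow> 'v \<Rightarrow> real" and Y' :: "nat \<Rightarrow> 'v \<Rightarrow> 'a"
    and g :: "real \<Rightarrow> 'a \<Rightarrow> 'a \<Rightarrow> real" and t \<theta> lam :: real
  assumes singletons: "\<And>x. x \<in> space M \<Longrightarrow> {x} \<in> sets M"
    and kernel: "jump_kernel M r"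
    and initial: "prob_space \<nu>" "sets \<nu> = sets M"
    and unperturbed: "unperturbed_process \<Omega> M \<nu> r T Y"
    and nonexplosion: "AE \<omega> in \<Omega>. explosion_time T \<omega> = \<infinity>"
    and t: "t > 0"
    and g_measurable: "(\<lambda>(s, x, y). g s x y) \<in>
          borel_measurable (restrict_space borel {0..t} \<Otimes>\<^sub>M M \<Otimes>\<^sub>M M)"
    and g_bounded: "bounded ((\<lambda>(s, x, y). g s x y) ` ({0..t} \<times> space M \<times> space M))"
    and \<theta>: "\<theta> > 0"
    and condition: "condition_C \<Omega> r T Y t \<theta> g"
    and lam_pos: "lam > 0"
    and lam_le: "ereal lam \<le> 1 / 8 * min (ereal \<theta>) (inverse (sup_abs M t g))"
    and perturbed: "perturbed_process \<Omega>' M \<nu> r t lam g T' Y'"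
  shows "measure \<Omega>' {\<omega> \<in> space \<Omega>'. explosion_time T' \<omega> > ereal t} = 1"
proof -
  \<comment> \<open>The same continuation by 0 as in \<open>perturbed_rate\<close>, which gives a
    perturbation defined and measurable at all times.\<close>
  define G where "G s x y = (if s \<in> {0..t} then g s x y else 0)" for s x y
  obtain B where B: "\<And>s x y. s \<in> {0..t} \<Longrightarrow> x \<in> space M \<Longrightarrow> y \<in> space M \<Longrightarrow> \<bar>g s x y\<bar> \<le> B"
    using g_bounded by (force simp: bounded_iff)
  have G_meas: "(\<lambda>(s, x, y). G s x y) \<in> borel_measurable (borel \<Otimes>\<^sub>M M \<Otimes>\<^sub>M M)"
  proof -
    let ?P = "borel \<Otimes>\<^sub>M M \<Otimes>\<^sub>M M" and ?D = "{0..t} \<times> space (M \<Otimes>\<^sub>M M)"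
    have D: "?D \<inter> space ?P \<in> sets ?P"
      by (intro sets.Int pair_measureI) auto
    have "(\<lambda>p. p) \<in> measurable (restrict_space ?P ?D) (restrict_space borel {0..t} \<Otimes>\<^sub>M M \<Otimes>\<^sub>M M)"
    proof -
      have "(\<lambda>p. (fst p, snd p)) \<in> measurable (restrict_space ?P ?D) (restrict_space borel {0..t} \<Otimes>\<^sub>M M \<Otimes>\<^sub>M M)"
        by (intro measurable_Pair measurable_restrict_space2 measurable_restrict_space1)
           (auto simp: space_restrict_space)
      then show ?thesis by simp
    qed
    from measurable_compose[OF this g_measurable]
    have "(\<lambda>p. if p \<in> ?D then (case p of (s, x, y) \<Rightarrow> g s x y) else 0) \<in> borel_measurable ?P"
      by (subst measurable_If_restrict_space_iff[OF _])
         (use D in \<open>auto simp: measurable_restrict_space1\<close>)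
    then show ?thesis
      by (rule measurable_cong[THEN iffD1, rotated]) (auto simp: G_def space_pair_measure split: if_splits)
  qed
  \<comment> \<open>The absolute value makes the bound visibly nonnegative, as needed at times
    outside \<open>{0..t}\<close>, where \<open>G\<close> is 0.\<close>
  interpret bounded_perturbation M r G "\<bar>B\<bar>"
  proof
    show "\<bar>G u x y\<bar> \<le> \<bar>B\<bar>" if "x \<in> space M" "y \<in> space M" for u x y
      using B[of u x y] that by (auto simp: G_def)
  qed (fact kernel G_meas)+
  have eighth: "(1 / 8 :: ereal) = ereal (1 / 8)"
    by (simp add: one_ereal_def numeral_eq_ereal)
  have "ereal lam \<le> 1 / 8 * ereal \<theta>"
    by (rule order_trans[OF lam_le]) (intro ereal_mult_left_mono, simp_all)
  then have lam_\<theta>: "lam \<le> \<theta> / 8" by (simp add: eighth)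
  have lam_sup: "ereal lam \<le> 1 / 8 * inverse (sup_abs M t g)"
    by (rule order_trans[OF lam_le]) (intro ereal_mult_left_mono, simp_all)
  \<comment> \<open>Points with \<open>G u x y = 0\<close> are split off, so that only inverses of
    positive numbers occur; this also settles the convention for a vanishing supremum.\<close>
  have G_small: "lam * \<bar>G u x y\<bar> \<le> 1 / 8" if xy: "x \<in> space M" "y \<in> space M" for u x y
  proof (cases "G u x y = 0")
    case False
    then have u: "u \<in> {0..t}" and pos: "0 < \<bar>g u x y\<bar>" and G: "G u x y = g u x y"
      by (auto simp: G_def split: if_splits)
    have "ereal \<bar>g u x y\<bar> \<le> sup_abs M t g"
      unfolding sup_abs_def using u xy by (intro SUP_upper2[of "(u, x, y)"]) auto
    then have "inverse (sup_abs M t g) \<le> inverse (ereal \<bar>g u x y\<bar>)"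
      by (intro ereal_inverse_antimono) simp_all
    then have "ereal lam \<le> 1 / 8 * inverse (ereal \<bar>g u x y\<bar>)"
      by (intro order_trans[OF lam_sup] ereal_mult_left_mono) simp_all
    then have "lam \<le> 1 / 8 * inverse \<bar>g u x y\<bar>"
      using pos by (simp add: eighth)
    then have "lam * \<bar>g u x y\<bar> \<le> 1 / 8 * inverse \<bar>g u x y\<bar> * \<bar>g u x y\<bar>"
      by (rule mult_right_mono) simp
    also have "\<dots> = 1 / 8" using pos by simp
    finally show ?thesis by (simp add: G)
  qed simp
  \<comment> \<open>Both parts of the minimum meet here: the bound by the supremum of |g| makes the
    square linear, and the bound by \<theta> turns \<lambda>|G| into \<theta>|G|.\<close>
  have square_le: "(exp (lam * G u x y) - 1)\<^sup>2 \<le> \<theta> * \<bar>G u x y\<bar>"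
    if xy: "x \<in> space M" "y \<in> space M" for u x y
  proof -
    have "(exp (lam * G u x y) - 1)\<^sup>2 \<le> \<bar>lam * G u x y\<bar>"
      using G_small[OF xy] lam_pos by (intro exp_minus_one_square_le) (simp add: abs_mult)
    also have "\<dots> \<le> \<theta> * \<bar>G u x y\<bar>"
      using lam_\<theta> lam_pos \<theta> by (simp add: abs_mult mult_right_mono)
    finally show ?thesis .
  qed
  have perturbed_rate_eq: "perturbed_rate t lam g r u x = density (r x) (\<lambda>y. ennreal (exp (lam * G u x y)))" for u x
    by (simp add: perturbed_rate_def G_def)
  interpret P: perturbed_jump_process M r G "\<bar>B\<bar>" \<Omega>' \<nu>
    "\<lambda>s x u. exp (- (LINT w:{s..u}|lborel. total_rate M (perturbed_rate t lam g r w x)))"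
    "perturbed_rate t lam g r" T' Y' lam
  proof (rule perturbed_jump_processI)
    show "jump_process \<Omega>' M \<nu> (\<lambda>s x u. exp (- (LINT w:{s..u}|lborel. total_rate M (perturbed_rate t lam g r w x))))
      (perturbed_rate t lam g r) T' Y'"
      using perturbed by (simp add: perturbed_process_def)
  qed (simp_all add: perturbed_rate_eq survival_def cumulative_rate_def total_rate_tilted)
  have untilted: "density (r x) (\<lambda>y. ennreal (exp (0 * G u x y))) = r x" for u x
    by (simp add: density_1)
  interpret U: perturbed_jump_process M r G "\<bar>B\<bar>" \<Omega> \<nu>
    "\<lambda>s x u. exp (- (total_rate M (r x) * (u - s)))" "\<lambda>_. r" T Y 0
  proof (rule perturbed_jump_processI)
    show "jump_process \<Omega> M \<nu> (\<lambda>s x u. exp (- (total_rate M (r x) * (u - s)))) (\<lambda>_. r) T Y"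
      using unperturbed by (simp add: unperturbed_process_def)
    fix s x u assume x: "x \<in> space M" and "(s::real) \<le> u"
    \<comment> \<open>With tilt 0 the rate is constant in time, so the general survival function
      reduces to the exponential one.\<close>
    have "rate 0 w x = total_rate M (r x)" for w
      using total_rate_tilted[OF x, of 0 w] unfolding untilted by simp
    then show "exp (- (total_rate M (r x) * (u - s))) = survival 0 s x u"
      using \<open>s \<le> u\<close> by (simp add: survival_def cumulative_rate_def set_lebesgue_integral_def mult.commute)
  qed (simp only: untilted)
  have "condition_C \<Omega> r T Y t \<theta> G"
  proof -
    have "(case state T Y s \<omega> of None \<Rightarrow> 0 | Some x \<Rightarrow> abs_rate r G s x) * indicator {0..t} s
      = (case state T Y s \<omega> of None \<Rightarrow> 0 | Some x \<Rightarrow> abs_rate r g s x) * indicator {0..t} s" for s \<omega>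
      by (auto simp: abs_rate_def G_def split: option.split split_indicator)
    then show ?thesis
      using condition by (simp add: condition_C_def)
  qed
  from U.weight_tendsto_0[OF nonexplosion this less_imp_le[OF \<theta>]]
  have "(\<lambda>n. \<integral>\<^sup>+x. backward 0 \<theta> t n 0 x \<partial>\<nu>) \<longlonglongrightarrow> 0"
    using t by (simp add: U.nn_integral_weight)
  then have small: "\<exists>n. (\<integral>\<^sup>+x. backward 0 \<theta> t n 0 x \<partial>\<nu>) < ennreal \<eta>" if "0 < \<eta>" for \<eta>
    using that order_tendstoD(2)[of _ 0 sequentially "ennreal \<eta>"] by (force simp: eventually_sequentially)
  have space_\<nu>: "space \<nu> = space M" using initial(2) by (rule sets_eq_imp_space_eq)
  have backward_\<nu>: "(\<lambda>x. backward 0 \<theta> t n 0 x) \<in> borel_measurable \<nu>" for n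
    unfolding measurable_cong_sets[OF initial(2) refl] by measurable
  show ?thesis
  proof (rule prob_explosion_time_gt)
    show "prob_space \<Omega>'" by (rule P.prob_space_axioms)
    show "T' n \<in> borel_measurable \<Omega>'" for n by (rule P.T_measurable)
    fix \<epsilon> :: real assume \<epsilon>: "0 < \<epsilon>"
    define \<delta> where "\<delta> = \<epsilon> / 2"
    have \<delta>: "0 < \<delta>" using \<epsilon> by (simp add: \<delta>_def)
    \<comment> \<open>The threshold 4\<delta>\<delta> makes the second term, carrying the factor 1 /
      (4\<delta>), at most \<delta>, so that both terms together give \<epsilon>.\<close>
    obtain n where n: "(\<integral>\<^sup>+x. backward 0 \<theta> t n 0 x \<partial>\<nu>) < ennreal (4 * \<delta> * \<delta>)"
      using small[of "4 * \<delta> * \<delta>"] \<delta> by auto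
    have "emeasure \<Omega>' {\<omega>\<in>space \<Omega>'. T' n \<omega> \<le> t} = (\<integral>\<^sup>+\<omega>. indicator {\<omega>\<in>space \<Omega>'. T' n \<omega> \<le> t} \<omega> \<partial>\<Omega>')"
      by (rule nn_integral_indicator[symmetric]) measurable
    \<comment> \<open>With \<open>a = 0\<close> the weight is 1, so the expectation identity yields
      the probability of \<open>n\<close> jumps by time \<open>t\<close>.\<close>
    also have "\<dots> = (\<integral>\<^sup>+\<omega>. ennreal (P.weight 0 n \<omega>) * indicator {..t} (T' n \<omega>) \<partial>\<Omega>')"
      by (intro nn_integral_cong) (simp add: P.weight_def indicator_def)
    also have "\<dots> = (\<integral>\<^sup>+x. backward lam 0 t n 0 x \<partial>\<nu>)"
      using t by (intro P.nn_integral_weight) simp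
    \<comment> \<open>Here the two processes meet: both sides are integrals against \<nu>, the left
      one from the perturbed process, the right one from the unperturbed process.\<close>
    also have "\<dots> \<le> (\<integral>\<^sup>+x. ennreal \<delta> + ennreal (1 / (4 * \<delta>)) * backward 0 \<theta> t n 0 x \<partial>\<nu>)"
      using \<theta> \<delta> square_le by (intro nn_integral_mono backward_le) (auto simp: space_\<nu>)
    also have "\<dots> = ennreal \<delta> + ennreal (1 / (4 * \<delta>)) * (\<integral>\<^sup>+x. backward 0 \<theta> t n 0 x \<partial>\<nu>)"
      using backward_\<nu> prob_space.emeasure_space_1[OF initial(1)]
      by (simp add: nn_integral_add nn_integral_cmult)
    also have "\<dots> \<le> ennreal \<delta> + ennreal (1 / (4 * \<delta>)) * ennreal (4 * \<delta> * \<delta>)"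
      using n by (intro add_left_mono mult_left_mono) simp_all
    also have "\<dots> = ennreal \<epsilon>"
      using \<delta> by (simp add: ennreal_mult[symmetric] ennreal_plus[symmetric] \<delta>_def del: ennreal_plus)
    finally show "\<exists>n. emeasure \<Omega>' {\<omega>\<in>space \<Omega>'. T' n \<omega> \<le> t} \<le> ennreal \<epsilon>" by blast
  qed
qed

end
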